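(* Let $\mathbf{k}$ be an algebraically closed field and let $\Lambda,\Lambda'$ be finite-dimensional $\mathbf{k}$-algebras. Write $\Lambda\text{-}\mathrm{Mod}$ for the category of all left $\Lambda$-modules and $\Lambda\text{-}\mathrm{mod}$ for the category of finite-dimensional left $\Lambda$-modules, and similarly for $\Lambda'$. (1) If $\Lambda'$ is brick-continuous and $F\colon \Lambda'\text{-}\mathrm{mod}\to\Lambda\text{-}\mathrm{mod}$ is a fully faithful exact functor, then $\Lambda$ is brick-continuous. (2) If $\Lambda'$ has a generic brick and $F\colon \Lambda'\text{-}\mathrm{Mod}\to\Lambda\text{-}\mathrm{Mod}$ is a fully faithful exact functor that preserves endofinite modules (that is, $F(M)$ is endofinite whenever $M$ is endofinite), then $\Lambda$ admits a generic brick.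
   Context: A brick is a module whose endomorphism ring is a division ring. A finite-dimensional $\mathbf{k}$-algebra $\Lambda$ is brick-continuous if it admits an infinite family of pairwise non-isomorphic bricks with the same (finite) dimension. The endolength of a $\Lambda$-module $M$ is its length as an $\operatorname{End}_\Lambda(M)^{\mathrm{op}}$-module; $M$ is endofinite if this is finite. A generic module is an indecomposable, endofinite $\Lambda$-module of infinite length over $\Lambda$. A generic brick is a generic module which is also a brick. *)

theory Defs
  imports
    "HOL-Algebra.Algebraic_Closure"
    "HOL-Algebra.AbelCoset"
    "HOL-Library.Extended_Nat"
    "HOL-Library.FuncSet"
    "Jordan_Normal_Form.Missing_VectorSpace"
begin

section \<open>Finite-dimensional algebras and their left modules\<close>

text \<open>
  The library locales \<^verbatim>\<open>algebra\<close> and \<^verbatim>\<open>module\<close> require commutativity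
  (of the algebra, respectively of the ring of scalars), hence the following two locales.
  The vector space structure and the ring structure of an algebra share one record.
\<close>

locale fd_algebra = vectorspace K A + A?: ring A for K and A (structure) +
  assumes smult_mult_left:
      "\<lbrakk>c \<in> carrier K; x \<in> carrier A; y \<in> carrier A\<rbrakk>
        \<Longrightarrow> c \<odot>\<^bsub>A\<^esub> (x \<otimes>\<^bsub>A\<^esub> y) = (c \<odot>\<^bsub>A\<^esub> x) \<otimes>\<^bsub>A\<^esub> y"
    and smult_mult_right:
      "\<lbrakk>c \<in> carrier K; x \<in> carrier A; y \<in> carrier A\<rbrakk>
        \<Longrightarrow> c \<odot>\<^bsub>A\<^esub> (x \<otimes>\<^bsub>A\<^esub> y) = x \<otimes>\<^bsub>A\<^esub> (c \<odot>\<^bsub>A\<^esub> y)"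
    and finite_dimensional: "fin_dim"

locale left_module = R?: ring R + M?: abelian_group M
  for R :: "('a, 'c) ring_scheme" and M :: "('a, 'm, 'd) module_scheme" (structure) +
  assumes lsmult_closed:
      "\<lbrakk>a \<in> carrier R; x \<in> carrier M\<rbrakk> \<Longrightarrow> a \<odot>\<^bsub>M\<^esub> x \<in> carrier M"
    and lsmult_l_distr:
      "\<lbrakk>a \<in> carrier R; b \<in> carrier R; x \<in> carrier M\<rbrakk>
        \<Longrightarrow> (a \<oplus>\<^bsub>R\<^esub> b) \<odot>\<^bsub>M\<^esub> x = a \<odot>\<^bsub>M\<^esub> x \<oplus>\<^bsub>M\<^esub> b \<odot>\<^bsub>M\<^esub> x"
    and lsmult_r_distr:
      "\<lbrakk>a \<in> carrier R; x \<in> carrier M; y \<in> carrier M\<rbrakk>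
        \<Longrightarrow> a \<odot>\<^bsub>M\<^esub> (x \<oplus>\<^bsub>M\<^esub> y) = a \<odot>\<^bsub>M\<^esub> x \<oplus>\<^bsub>M\<^esub> a \<odot>\<^bsub>M\<^esub> y"
    and lsmult_assoc:
      "\<lbrakk>a \<in> carrier R; b \<in> carrier R; x \<in> carrier M\<rbrakk>
        \<Longrightarrow> (a \<otimes>\<^bsub>R\<^esub> b) \<odot>\<^bsub>M\<^esub> x = a \<odot>\<^bsub>M\<^esub> (b \<odot>\<^bsub>M\<^esub> x)"
    and lsmult_one: "x \<in> carrier M \<Longrightarrow> \<one>\<^bsub>R\<^esub> \<odot>\<^bsub>M\<^esub> x = x"

text \<open>
  The underlying vector space of a module over an algebra \<open>A\<close>: the scalar \<open>c\<close> acts as \<open>c 1\<^sub>A\<close>.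
  (The fields \<open>mult\<close> and \<open>one\<close>, which a module record inherits from the ring record, carry no
  information for a module.)
\<close>

definition underlying_vs ::
    "('k, 'a) module \<Rightarrow> ('a, 'm) module \<Rightarrow> ('k, 'm) module" where
  "underlying_vs A M =
    \<lparr>carrier = carrier M, monoid.mult = monoid.mult M, one = one M, zero = zero M, add = add M,
     smult = (\<lambda>c x. (c \<odot>\<^bsub>A\<^esub> \<one>\<^bsub>A\<^esub>) \<odot>\<^bsub>M\<^esub> x)\<rparr>"

definition fd_dim ::
    "('k, 'c) ring_scheme \<Rightarrow> ('k, 'a) module \<Rightarrow> ('a, 'm) module \<Rightarrow> nat" where
  "fd_dim K A M = vectorspace.dim K (underlying_vs A M)"


section \<open>Module categories\<close>

text \<open>
  Objects are modules whose carrier is a set of elements of a type \<open>'m\<close>, the universe.  The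
  theorem is polymorphic in its universes, so they may be chosen as large as desired.  Every
  finite-dimensional module over an algebra on a field of type \<open>'k\<close> is isomorphic to one in any
  universe at least as large as that field, e.g. \<open>nat \<Rightarrow> 'k\<close>.
\<close>

definition all_modules :: "('a, 'c) ring_scheme \<Rightarrow> ('a, 'm) module set" where
  "all_modules R = {M. left_module R M}"

definition fd_modules ::
    "('k, 'c) ring_scheme \<Rightarrow> ('k, 'a) module \<Rightarrow> ('a, 'm) module set" where
  "fd_modules K A = {M. left_module A M \<and> vectorspace.fin_dim K (underlying_vs A M)}"

text \<open>
  Morphisms are made \<open>undefined\<close> outside the carrier of the source, so that equality of
  functions is equality of morphisms.
\<close>

definition Hom ::
    "('a, 'c) ring_scheme \<Rightarrow> ('a, 'm) module \<Rightarrow> ('a, 'n) module \<Rightarrow> ('m \<Rightarrow> 'n) set" where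
  "Hom R M N = module_hom R M N \<inter> extensional (carrier M)"

definition isomorphic_modules ::
    "('a, 'c) ring_scheme \<Rightarrow> ('a, 'm) module \<Rightarrow> ('a, 'n) module \<Rightarrow> bool" where
  "isomorphic_modules R M N \<longleftrightarrow> (\<exists>f\<in>Hom R M N. bij_betw f (carrier M) (carrier N))"

definition short_exact ::
    "('a, 'c) ring_scheme \<Rightarrow> ('a, 'm) module \<Rightarrow> ('a, 'm) module \<Rightarrow> ('a, 'm) module
      \<Rightarrow> ('m \<Rightarrow> 'm) \<Rightarrow> ('m \<Rightarrow> 'm) \<Rightarrow> bool" where
  "short_exact R L M N f g \<longleftrightarrow>
     f \<in> Hom R L M \<and> g \<in> Hom R M N \<and>
     inj_on f (carrier L) \<and>
     f ` carrier L = {x \<in> carrier M. g x = \<zero>\<^bsub>N\<^esub>} \<and>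
     g ` carrier M = carrier N"

text \<open>
  A functor between full subcategories of module categories; these are given by their classes of
  objects \<open>C\<close> and \<open>D\<close>.  The value of a functor on a morphism \<open>f\<close> from \<open>M\<close> to \<open>N\<close> is
  \<open>arr F M N f\<close>, since a function does not determine its target.
\<close>

record ('a, 'm, 'b, 'n) mod_functor =
  obj :: "('a, 'm) module \<Rightarrow> ('b, 'n) module"
  arr :: "('a, 'm) module \<Rightarrow> ('a, 'm) module \<Rightarrow> ('m \<Rightarrow> 'm) \<Rightarrow> ('n \<Rightarrow> 'n)"

locale module_functor =
  fixes R :: "('a, 'c) ring_scheme" and C :: "('a, 'm) module set"
    and S :: "('b, 'd) ring_scheme" and D :: "('b, 'n) module set"
    and F :: "('a, 'm, 'b, 'n) mod_functor"
  assumes obj_closed: "M \<in> C \<Longrightarrow> obj F M \<in> D"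
    and arr_closed:
      "\<lbrakk>M \<in> C; N \<in> C; f \<in> Hom R M N\<rbrakk> \<Longrightarrow> arr F M N f \<in> Hom S (obj F M) (obj F N)"
    and arr_id:
      "M \<in> C \<Longrightarrow> arr F M M (\<lambda>x\<in>carrier M. x) = (\<lambda>x\<in>carrier (obj F M). x)"
    and arr_comp:
      "\<lbrakk>L \<in> C; M \<in> C; N \<in> C; f \<in> Hom R L M; g \<in> Hom R M N\<rbrakk>
        \<Longrightarrow> arr F L N (compose (carrier L) g f)
            = compose (carrier (obj F L)) (arr F M N g) (arr F L M f)"

definition fully_faithful ::
    "('a, 'c) ring_scheme \<Rightarrow> ('a, 'm) module set \<Rightarrow> ('b, 'd) ring_scheme
      \<Rightarrow> ('a, 'm, 'b, 'n) mod_functor \<Rightarrow> bool" where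
  "fully_faithful R C S F \<longleftrightarrow>
     (\<forall>M\<in>C. \<forall>N\<in>C. bij_betw (arr F M N) (Hom R M N) (Hom S (obj F M) (obj F N)))"

text \<open>
  Additivity is not demanded separately: a functor that preserves short exact sequences preserves
  the split ones, hence biproducts.
\<close>

definition exact_functor ::
    "('a, 'c) ring_scheme \<Rightarrow> ('a, 'm) module set \<Rightarrow> ('b, 'd) ring_scheme
      \<Rightarrow> ('a, 'm, 'b, 'n) mod_functor \<Rightarrow> bool" where
  "exact_functor R C S F \<longleftrightarrow>
     (\<forall>L\<in>C. \<forall>M\<in>C. \<forall>N\<in>C. \<forall>f g. short_exact R L M N f g \<longrightarrow>
        short_exact S (obj F L) (obj F M) (obj F N) (arr F L M f) (arr F M N g))"


section \<open>Bricks\<close>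

locale skew_field = ring R for R (structure) +
  assumes one_neq_zero: "\<one> \<noteq> \<zero>"
    and nonzero_Units: "x \<in> carrier R - {\<zero>} \<Longrightarrow> x \<in> Units R"

definition end_ring ::
    "('a, 'c) ring_scheme \<Rightarrow> ('a, 'm) module \<Rightarrow> ('m \<Rightarrow> 'm) ring" where
  "end_ring R M =
    \<lparr>carrier = Hom R M M,
     monoid.mult = (\<lambda>f g. compose (carrier M) f g),
     one = (\<lambda>x\<in>carrier M. x),
     zero = (\<lambda>x\<in>carrier M. \<zero>\<^bsub>M\<^esub>),
     add = (\<lambda>f g. \<lambda>x\<in>carrier M. f x \<oplus>\<^bsub>M\<^esub> g x)\<rparr>"

definition brick :: "('a, 'c) ring_scheme \<Rightarrow> ('a, 'm) module \<Rightarrow> bool" where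
  "brick R M \<longleftrightarrow> left_module R M \<and> skew_field (end_ring R M)"

definition brick_continuous ::
    "'m itself \<Rightarrow> ('k, 'c) ring_scheme \<Rightarrow> ('k, 'a) module \<Rightarrow> bool" where
  "brick_continuous (U :: 'm itself) K A \<longleftrightarrow>
     (\<exists>(d :: nat) (\<B> :: ('a, 'm) module set).
        infinite \<B> \<and>
        (\<forall>M\<in>\<B>. M \<in> fd_modules K A \<and> brick A M \<and> fd_dim K A M = d) \<and>
        (\<forall>M\<in>\<B>. \<forall>N\<in>\<B>. M \<noteq> N \<longrightarrow> \<not> isomorphic_modules A M N))"


section \<open>Length, endolength and generic modules\<close>

text \<open>
  The length of a module is the supremum of the lengths of its strict chains of submodules.
  \<^verbatim>\<open>Module.submodule\<close> is the submodule notion of HOL-Algebra, which does not need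
  commutative scalars, as opposed to the locale of the same name in the vector space library.
\<close>

definition module_length :: "('a, 'c) ring_scheme \<Rightarrow> ('a, 'm) module \<Rightarrow> enat" where
  "module_length R M =
     Sup {enat n | n. \<exists>N. (\<forall>i\<le>n. Module.submodule (N i) R M) \<and> (\<forall>i<n. N i \<subset> N (Suc i))}"

text \<open>
  \<open>M\<close> as a left module over its endomorphism ring under evaluation, which is the same thing as
  \<open>M\<close> as a right module over the opposite of the endomorphism ring.
\<close>

definition endo_module :: "('a, 'm) module \<Rightarrow> ('m \<Rightarrow> 'm, 'm) module" where
  "endo_module M =
    \<lparr>carrier = carrier M, monoid.mult = monoid.mult M, one = one M, zero = zero M, add = add M,
     smult = (\<lambda>f x. f x)\<rparr>"

definition endolength :: "('a, 'c) ring_scheme \<Rightarrow> ('a, 'm) module \<Rightarrow> enat" where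
  "endolength R M = module_length (end_ring R M) (endo_module M)"

definition endofinite :: "('a, 'c) ring_scheme \<Rightarrow> ('a, 'm) module \<Rightarrow> bool" where
  "endofinite R M \<longleftrightarrow> endolength R M < \<infinity>"

definition indecomposable_module :: "('a, 'c) ring_scheme \<Rightarrow> ('a, 'm) module \<Rightarrow> bool" where
  "indecomposable_module R M \<longleftrightarrow>
     carrier M \<noteq> {\<zero>\<^bsub>M\<^esub>} \<and>
     (\<forall>P Q. Module.submodule P R M \<longrightarrow> Module.submodule Q R M \<longrightarrow>
        P \<inter> Q = {\<zero>\<^bsub>M\<^esub>} \<longrightarrow> P <+>\<^bsub>M\<^esub> Q = carrier M \<longrightarrow>
        P = {\<zero>\<^bsub>M\<^esub>} \<or> Q = {\<zero>\<^bsub>M\<^esub>})"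

definition generic_module :: "('a, 'c) ring_scheme \<Rightarrow> ('a, 'm) module \<Rightarrow> bool" where
  "generic_module R M \<longleftrightarrow>
     left_module R M \<and> indecomposable_module R M \<and> endofinite R M \<and> module_length R M = \<infinity>"

definition generic_brick :: "('a, 'c) ring_scheme \<Rightarrow> ('a, 'm) module \<Rightarrow> bool" where
  "generic_brick R M \<longleftrightarrow> generic_module R M \<and> brick R M"

end

theory Submission
  imports Defs
begin

text \<open>
  Both parts rest on three properties of a fully faithful functor \<open>F\<close>.  It reflects isomorphisms.
  It preserves bricks: it restricts to an isomorphism between the multiplicative monoids of the
  endomorphism rings of \<open>M\<close> and \<open>F M\<close>, and whether a ring is a skew field depends only on that
  monoid (\<open>brick_obj\<close>).  And if \<open>F\<close> is exact, it turns short exact sequences into short exact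
  sequences, so it preserves injections and surjections.

  For generic bricks, let \<open>M\<close> be one.  The image \<open>F M\<close> is a brick, hence indecomposable, because a
  direct decomposition would give a nontrivial idempotent in a skew field
  (\<open>brick_indecomposable\<close>).  It is endofinite by hypothesis.  It has infinite length because \<open>F\<close>
  sends strict chains of submodules of \<open>M\<close> to strict chains of submodules of \<open>F M\<close>: injections stay
  injections, and an inclusion that becomes an isomorphism was one already (\<open>module_length_le\<close>).

  For brick-continuity, infinitely many pairwise non-isomorphic bricks of dimension \<open>d\<close> are sent to
  infinitely many pairwise non-isomorphic bricks, and what remains is to control dimensions.  Every
  module of dimension \<open>d\<close> is generated by \<open>d\<close> elements, so it is a quotient of the free module \<open>P\<close>
  of rank \<open>d\<close>.  By exactness \<open>F M\<close> is a quotient of \<open>F P\<close>, so all the dimensions of the images are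
  at most that of \<open>F P\<close>, and infinitely many of them coincide.

  The universes of the two categories may be small, so each auxiliary module has to be found inside
  the universe of the given ones.  Submodules of its members belong to it, and quotients are formed from coset
  representatives (\<open>quotient_module\<close>).  The free module \<open>P\<close> fits because the field, being
  algebraically closed, is infinite: its finite powers are then no larger than the field itself,
  and a nonzero module of the universe contains a copy of the field
  (\<open>free_carrier_embeds\<close>, \<open>fd_generator_exists\<close>).
\<close>

section \<open>Left modules and their homomorphisms\<close>

lemma HomI:
  assumes "\<And>x. x \<in> carrier M \<Longrightarrow> f x \<in> carrier N"
    and "\<And>x y. \<lbrakk>x \<in> carrier M; y \<in> carrier M\<rbrakk> \<Longrightarrow> f (x \<oplus>\<^bsub>M\<^esub> y) = f x \<oplus>\<^bsub>N\<^esub> f y"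
    and "\<And>a x. \<lbrakk>a \<in> carrier R; x \<in> carrier M\<rbrakk> \<Longrightarrow> f (a \<odot>\<^bsub>M\<^esub> x) = a \<odot>\<^bsub>N\<^esub> f x"
    and "f \<in> extensional (carrier M)"
  shows "f \<in> Hom R M N"
  using assms by (auto simp: Hom_def module_hom_def)

lemma
  assumes "f \<in> Hom R M N"
  shows Hom_closed: "x \<in> carrier M \<Longrightarrow> f x \<in> carrier N"
    and Hom_add: "\<lbrakk>x \<in> carrier M; y \<in> carrier M\<rbrakk> \<Longrightarrow> f (x \<oplus>\<^bsub>M\<^esub> y) = f x \<oplus>\<^bsub>N\<^esub> f y"
    and Hom_smult: "\<lbrakk>a \<in> carrier R; x \<in> carrier M\<rbrakk> \<Longrightarrow> f (a \<odot>\<^bsub>M\<^esub> x) = a \<odot>\<^bsub>N\<^esub> f x"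
    and Hom_extensional: "f \<in> extensional (carrier M)"
  using assms by (auto simp: Hom_def module_hom_def)

context left_module
begin

lemma lsmult_zero: "a \<in> carrier R \<Longrightarrow> a \<odot>\<^bsub>M\<^esub> \<zero>\<^bsub>M\<^esub> = \<zero>\<^bsub>M\<^esub>"
  by (metis M.add.l_cancel_one M.zero_closed M.l_zero lsmult_closed lsmult_r_distr)

lemma zero_lsmult: "x \<in> carrier M \<Longrightarrow> \<zero>\<^bsub>R\<^esub> \<odot>\<^bsub>M\<^esub> x = \<zero>\<^bsub>M\<^esub>"
  by (metis M.add.l_cancel_one R.zero_closed R.l_zero lsmult_closed lsmult_l_distr)

lemma lsmult_minus:
  assumes "a \<in> carrier R" "x \<in> carrier M"
  shows "a \<odot>\<^bsub>M\<^esub> (\<ominus>\<^bsub>M\<^esub> x) = \<ominus>\<^bsub>M\<^esub> (a \<odot>\<^bsub>M\<^esub> x)"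
proof -
  have "a \<odot>\<^bsub>M\<^esub> (\<ominus>\<^bsub>M\<^esub> x) \<oplus>\<^bsub>M\<^esub> a \<odot>\<^bsub>M\<^esub> x = \<zero>\<^bsub>M\<^esub>"
    using assms by (metis M.a_inv_closed M.l_neg lsmult_r_distr lsmult_zero)
  then show ?thesis
    using assms by (metis M.a_inv_closed M.minus_equality lsmult_closed)
qed

lemma minus_eq_lsmult:
  assumes "x \<in> carrier M"
  shows "\<ominus>\<^bsub>M\<^esub> x = (\<ominus>\<^bsub>R\<^esub> \<one>\<^bsub>R\<^esub>) \<odot>\<^bsub>M\<^esub> x"
proof -
  have "(\<ominus>\<^bsub>R\<^esub> \<one>\<^bsub>R\<^esub>) \<odot>\<^bsub>M\<^esub> x \<oplus>\<^bsub>M\<^esub> x = \<zero>\<^bsub>M\<^esub>"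
    using assms lsmult_l_distr[of "\<ominus>\<^bsub>R\<^esub> \<one>\<^bsub>R\<^esub>" "\<one>\<^bsub>R\<^esub>" x]
    by (simp add: lsmult_one zero_lsmult R.l_neg)
  then show ?thesis
    using assms by (intro M.minus_equality) (auto intro: lsmult_closed)
qed

lemma submoduleI:
  assumes "N \<subseteq> carrier M" "\<zero>\<^bsub>M\<^esub> \<in> N"
    and "\<And>x y. \<lbrakk>x \<in> N; y \<in> N\<rbrakk> \<Longrightarrow> x \<oplus>\<^bsub>M\<^esub> y \<in> N"
    and sm: "\<And>a x. \<lbrakk>a \<in> carrier R; x \<in> N\<rbrakk> \<Longrightarrow> a \<odot>\<^bsub>M\<^esub> x \<in> N"
  shows "Module.submodule N R M"
proof -
  have "\<ominus>\<^bsub>M\<^esub> x \<in> N" if "x \<in> N" for x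
    using that assms(1) sm[of "\<ominus>\<^bsub>R\<^esub> \<one>\<^bsub>R\<^esub>" x] minus_eq_lsmult[of x] by auto
  then show ?thesis
    using assms by (intro Module.submodule.intro subgroup.intro)
      (auto simp: Module.submodule_axioms_def a_inv_def)
qed

lemma
  assumes "Module.submodule N R M"
  shows submodule_subset: "N \<subseteq> carrier M"
    and submodule_zero: "\<zero>\<^bsub>M\<^esub> \<in> N"
    and submodule_add: "\<lbrakk>x \<in> N; y \<in> N\<rbrakk> \<Longrightarrow> x \<oplus>\<^bsub>M\<^esub> y \<in> N"
    and submodule_smult: "\<lbrakk>a \<in> carrier R; x \<in> N\<rbrakk> \<Longrightarrow> a \<odot>\<^bsub>M\<^esub> x \<in> N"
    and submodule_minus: "x \<in> N \<Longrightarrow> \<ominus>\<^bsub>M\<^esub> x \<in> N"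
proof -
  interpret N: Module.submodule N R M by fact
  show "N \<subseteq> carrier M" using N.subset by simp
  show "\<zero>\<^bsub>M\<^esub> \<in> N" using N.one_closed by simp
  show "\<lbrakk>x \<in> N; y \<in> N\<rbrakk> \<Longrightarrow> x \<oplus>\<^bsub>M\<^esub> y \<in> N" using N.m_closed by simp
  show "\<lbrakk>a \<in> carrier R; x \<in> N\<rbrakk> \<Longrightarrow> a \<odot>\<^bsub>M\<^esub> x \<in> N" by (rule N.smult_closed)
  show "x \<in> N \<Longrightarrow> \<ominus>\<^bsub>M\<^esub> x \<in> N" using N.m_inv_closed by (simp add: a_inv_def)
qed

lemma left_module_submodule:
  assumes N: "Module.submodule N R M"
  shows "left_module R (M\<lparr>carrier := N\<rparr>)"
proof -
  note sub = subsetD[OF submodule_subset[OF N]]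
  have "abelian_group (M\<lparr>carrier := N\<rparr>)"
  proof (rule abelian_groupI)
    fix x assume "x \<in> carrier (M\<lparr>carrier := N\<rparr>)"
    then have "x \<in> N" by simp
    then have "\<ominus>\<^bsub>M\<^esub> x \<in> N \<and> \<ominus>\<^bsub>M\<^esub> x \<oplus>\<^bsub>M\<^esub> x = \<zero>\<^bsub>M\<^esub>"
      using submodule_minus[OF N] sub by (simp add: M.l_neg)
    then show "\<exists>y\<in>carrier (M\<lparr>carrier := N\<rparr>). y \<oplus>\<^bsub>M\<lparr>carrier := N\<rparr>\<^esub> x = \<zero>\<^bsub>M\<lparr>carrier := N\<rparr>\<^esub>"
      by auto
  qed (auto simp: submodule_zero[OF N] submodule_add[OF N] sub intro: M.a_assoc M.a_comm)
  then show ?thesis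
    by (intro left_module.intro left_module_axioms.intro R.ring_axioms)
      (use submodule_smult[OF N] sub in
        \<open>auto simp: lsmult_l_distr lsmult_r_distr lsmult_assoc lsmult_one\<close>)
qed

end

lemma inclusion_Hom:
  assumes "left_module R M" "Module.submodule N R M" "N \<subseteq> N'"
  shows "(\<lambda>x\<in>N. x) \<in> Hom R (M\<lparr>carrier := N\<rparr>) (M\<lparr>carrier := N'\<rparr>)"
  using assms left_module.submodule_add[OF assms(1,2)] left_module.submodule_smult[OF assms(1,2)]
  by (intro HomI) auto

lemma Hom_zero:
  assumes "left_module R M" "left_module R N" "f \<in> Hom R M N"
  shows "f \<zero>\<^bsub>M\<^esub> = \<zero>\<^bsub>N\<^esub>"
proof -
  interpret M: left_module R M by fact
  interpret N: left_module R N by fact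
  have "f \<zero>\<^bsub>M\<^esub> = f (\<zero>\<^bsub>R\<^esub> \<odot>\<^bsub>M\<^esub> \<zero>\<^bsub>M\<^esub>)" by (simp add: M.zero_lsmult)
  also have "\<dots> = \<zero>\<^bsub>N\<^esub>"
    using Hom_smult[OF assms(3)] Hom_closed[OF assms(3)] by (simp add: N.zero_lsmult)
  finally show ?thesis .
qed

lemma identity_Hom: "left_module R M \<Longrightarrow> (\<lambda>x\<in>carrier M. x) \<in> Hom R M M"
  by (rule HomI) (auto simp: left_module.lsmult_closed
      abelian_monoid.a_closed[OF abelian_group.axioms(1)] left_module.axioms)

lemma compose_Hom:
  assumes "left_module R L" "f \<in> Hom R L M" "g \<in> Hom R M N"
  shows "compose (carrier L) g f \<in> Hom R L N"
proof -
  interpret L: left_module R L by fact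
  show ?thesis
    by (rule HomI)
      (simp_all add: compose_eq Hom_closed[OF assms(2)] Hom_closed[OF assms(3)]
        Hom_add[OF assms(2)] Hom_add[OF assms(3)] Hom_smult[OF assms(2)] Hom_smult[OF assms(3)]
        L.lsmult_closed)
qed

lemma inverse_Hom:
  assumes "left_module R M" "f \<in> Hom R M N" "bij_betw f (carrier M) (carrier N)"
  shows "(\<lambda>y\<in>carrier N. inv_into (carrier M) f y) \<in> Hom R N M" (is "?g \<in> _")
proof -
  interpret M: left_module R M by fact
  have inv: "inv_into (carrier M) f y \<in> carrier M" "f (inv_into (carrier M) f y) = y"
    if "y \<in> carrier N" for y
    using that assms(3) by (auto simp: bij_betw_def intro: inv_into_into f_inv_into_f)
  have eq: "inv_into (carrier M) f y = x" if "x \<in> carrier M" "f x = y" for x y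
    using that assms(3) by (auto simp: bij_betw_def)
  have add: "x \<oplus>\<^bsub>N\<^esub> y \<in> carrier N \<and> ?g (x \<oplus>\<^bsub>N\<^esub> y) = ?g x \<oplus>\<^bsub>M\<^esub> ?g y"
    if xy: "x \<in> carrier N" "y \<in> carrier N" for x y
  proof -
    define u v where "u = inv_into (carrier M) f x" and "v = inv_into (carrier M) f y"
    have uv: "u \<in> carrier M" "v \<in> carrier M" "f u = x" "f v = y"
      using inv xy by (auto simp: u_def v_def)
    then have f: "f (u \<oplus>\<^bsub>M\<^esub> v) = x \<oplus>\<^bsub>N\<^esub> y" using Hom_add[OF assms(2)] by simp
    then have "x \<oplus>\<^bsub>N\<^esub> y \<in> carrier N" using Hom_closed[OF assms(2)] uv M.a_closed by metis
    then show ?thesis using eq[OF _ f] uv xy by (simp add: u_def v_def)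
  qed
  have smult: "a \<odot>\<^bsub>N\<^esub> y \<in> carrier N \<and> ?g (a \<odot>\<^bsub>N\<^esub> y) = a \<odot>\<^bsub>M\<^esub> ?g y"
    if ay: "a \<in> carrier R" "y \<in> carrier N" for a y
  proof -
    define v where "v = inv_into (carrier M) f y"
    have v: "v \<in> carrier M" "f v = y" using inv ay by (auto simp: v_def)
    then have f: "f (a \<odot>\<^bsub>M\<^esub> v) = a \<odot>\<^bsub>N\<^esub> y" using Hom_smult[OF assms(2)] ay by simp
    then have "a \<odot>\<^bsub>N\<^esub> y \<in> carrier N"
      using Hom_closed[OF assms(2)] v ay M.lsmult_closed by metis
    then show ?thesis using eq[OF _ f] v ay by (simp add: v_def M.lsmult_closed)
  qed
  show ?thesis
    by (rule HomI) (use inv add[THEN conjunct2] smult[THEN conjunct2] in \<open>simp_all only: restrict_apply' restrict_extensional\<close>)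
qed

lemma submodule_image:
  assumes "left_module R M" "left_module R N" "f \<in> Hom R M N"
  shows "Module.submodule (f ` carrier M) R N"
proof -
  interpret M: left_module R M by fact
  interpret N: left_module R N by fact
  show ?thesis
  proof (rule N.submoduleI)
    show "f ` carrier M \<subseteq> carrier N" using Hom_closed[OF assms(3)] by auto
    show "\<zero>\<^bsub>N\<^esub> \<in> f ` carrier M" using Hom_zero[OF assms] M.zero_closed by (metis imageI)
    show "x \<oplus>\<^bsub>N\<^esub> y \<in> f ` carrier M" if "x \<in> f ` carrier M" "y \<in> f ` carrier M" for x y
      using that Hom_add[OF assms(3)] M.a_closed by (smt (verit) imageE imageI)
    show "a \<odot>\<^bsub>N\<^esub> x \<in> f ` carrier M" if "a \<in> carrier R" "x \<in> f ` carrier M" for a x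
      using that Hom_smult[OF assms(3)] M.lsmult_closed by (smt (verit) imageE imageI)
  qed
qed

lemma submodule_kernel:
  assumes "left_module R M" "left_module R N" "f \<in> Hom R M N"
  shows "Module.submodule {x \<in> carrier M. f x = \<zero>\<^bsub>N\<^esub>} R M"
proof -
  interpret M: left_module R M by fact
  interpret N: left_module R N by fact
  show ?thesis
    by (rule M.submoduleI)
      (auto simp: Hom_zero[OF assms] Hom_add[OF assms(3)] Hom_smult[OF assms(3)]
        M.lsmult_closed N.lsmult_zero)
qed

text \<open>
  This is how every short exact sequence below arises: an epimorphism is completed by its kernel,
  which lives in the same universe because it is a subset of the source.
\<close>

lemma short_exact_kernel:
  assumes "left_module R M" "left_module R N" "f \<in> Hom R M N" "f ` carrier M = carrier N"
  defines "L \<equiv> {x \<in> carrier M. f x = \<zero>\<^bsub>N\<^esub>}"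
  shows "short_exact R (M\<lparr>carrier := L\<rparr>) M N (\<lambda>x\<in>L. x) f"
proof -
  interpret M: left_module R M by fact
  have "(\<lambda>x\<in>L. x) \<in> Hom R (M\<lparr>carrier := L\<rparr>) (M\<lparr>carrier := carrier M\<rparr>)"
    using submodule_kernel[OF assms(1-3)] unfolding L_def by (intro inclusion_Hom assms(1)) auto
  then show ?thesis
    using assms(3,4) by (auto simp: short_exact_def L_def inj_on_def)
qed

section \<open>Endomorphism rings and bricks\<close>

lemma Hom_plus:
  assumes "left_module R M" "left_module R N" "f \<in> Hom R M N" "g \<in> Hom R M N"
  shows "(\<lambda>x\<in>carrier M. f x \<oplus>\<^bsub>N\<^esub> g x) \<in> Hom R M N"
proof -
  interpret M: left_module R M by fact
  interpret N: left_module R N by fact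
  note fg = assms(3,4)
  show ?thesis
    by (rule HomI)
      (simp_all add: Hom_closed[OF fg(1)] Hom_closed[OF fg(2)] Hom_add[OF fg(1)] Hom_add[OF fg(2)]
        Hom_smult[OF fg(1)] Hom_smult[OF fg(2)] M.lsmult_closed N.lsmult_r_distr
        N.a_ac)
qed

lemma Hom_const_zero:
  assumes "left_module R M" "left_module R N"
  shows "(\<lambda>x\<in>carrier M. \<zero>\<^bsub>N\<^esub>) \<in> Hom R M N"
proof -
  interpret M: left_module R M by fact
  interpret N: left_module R N by fact
  show ?thesis by (rule HomI) (simp_all add: M.lsmult_closed N.lsmult_zero)
qed

lemma Hom_uminus:
  assumes "left_module R M" "left_module R N" "f \<in> Hom R M N"
  shows "(\<lambda>x\<in>carrier M. \<ominus>\<^bsub>N\<^esub> f x) \<in> Hom R M N"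
proof -
  interpret M: left_module R M by fact
  interpret N: left_module R N by fact
  show ?thesis
    by (rule HomI)
      (simp_all add: Hom_closed[OF assms(3)] Hom_add[OF assms(3)] Hom_smult[OF assms(3)]
        M.lsmult_closed N.lsmult_minus N.minus_add)
qed

lemma ring_end_ring:
  assumes M: "left_module R M"
  shows "ring (end_ring R M)"
proof -
  interpret M: left_module R M by fact
  have E: "f \<in> Hom R M M \<Longrightarrow> x \<in> carrier M \<Longrightarrow> f x \<in> carrier M" for f x by (rule Hom_closed)
  note eqI = extensionalityI[of _ "carrier M"]
  show ?thesis
  proof (rule ringI)
    show "abelian_group (end_ring R M)"
    proof (rule abelian_groupI)
      fix f assume "f \<in> carrier (end_ring R M)"
      then have f: "f \<in> Hom R M M" by (simp add: end_ring_def)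
      show "\<exists>g\<in>carrier (end_ring R M). g \<oplus>\<^bsub>end_ring R M\<^esub> f = \<zero>\<^bsub>end_ring R M\<^esub>"
        using Hom_uminus[OF M M f] Hom_closed[OF f]
        by (intro bexI[of _ "\<lambda>x\<in>carrier M. \<ominus>\<^bsub>M\<^esub> f x"])
          (auto simp: end_ring_def M.l_neg intro: eqI)
      show "\<zero>\<^bsub>end_ring R M\<^esub> \<oplus>\<^bsub>end_ring R M\<^esub> f = f"
        using E[OF f] Hom_extensional[OF f] by (auto simp: end_ring_def intro: eqI)
    qed (auto simp: end_ring_def Hom_plus[OF M M] Hom_const_zero[OF M M] E M.a_assoc
        intro!: eqI intro: M.a_comm[OF E E])
    show "monoid (end_ring R M)"
      by (rule monoidI)
        (auto simp: end_ring_def compose_Hom[OF M] identity_Hom[OF M] compose_eq E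
          Hom_extensional intro!: eqI)
  qed (auto simp: end_ring_def compose_eq E Hom_add intro!: eqI)
qed

lemma (in monoid) idempotent_Unit:
  assumes "x \<in> Units G" "x \<otimes> x = x"
  shows "x = \<one>"
proof -
  note x = assms(1) Units_closed[OF assms(1)]
  show ?thesis using m_assoc[of x x "inv x"] x assms(2) by simp
qed

lemma brick_not_zero:
  assumes "brick R M"
  shows "carrier M \<noteq> {\<zero>\<^bsub>M\<^esub>}"
proof
  assume "carrier M = {\<zero>\<^bsub>M\<^esub>}"
  then have "\<one>\<^bsub>end_ring R M\<^esub> = \<zero>\<^bsub>end_ring R M\<^esub>"
    by (auto simp: end_ring_def)
  then show False
    using assms skew_field.one_neq_zero by (auto simp: brick_def)
qed

text \<open>
  A decomposition of \<open>M\<close> into \<open>P\<close> and \<open>Q\<close> yields an idempotent endomorphism, the projection onto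
  \<open>P\<close>.  In a skew field the only idempotents are zero, which forces \<open>P = 0\<close>, and one, which
  forces \<open>Q = 0\<close>.
\<close>

lemma brick_indecomposable:
  assumes "brick R M"
  shows "indecomposable_module R M"
  unfolding indecomposable_module_def
proof (intro conjI allI impI)
  show "carrier M \<noteq> {\<zero>\<^bsub>M\<^esub>}" using assms by (rule brick_not_zero)
  fix P Q
  assume P: "Module.submodule P R M" and Q: "Module.submodule Q R M"
    and PQ: "P \<inter> Q = {\<zero>\<^bsub>M\<^esub>}" "P <+>\<^bsub>M\<^esub> Q = carrier M"
  have M: "left_module R M" using assms by (simp add: brick_def)
  interpret M: left_module R M by fact
  interpret E: skew_field "end_ring R M" using assms by (simp add: brick_def)
  note subP = subsetD[OF M.submodule_subset[OF P]] and subQ = subsetD[OF M.submodule_subset[OF Q]]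
  have ex: "\<exists>p\<in>P. \<exists>q\<in>Q. x = p \<oplus>\<^bsub>M\<^esub> q" if "x \<in> carrier M" for x
    using that unfolding PQ(2)[symmetric] by (auto simp: set_add_def set_mult_def)
  have unique: "p = p'" if "p \<in> P" "p' \<in> P" "q \<in> Q" "q' \<in> Q" "p \<oplus>\<^bsub>M\<^esub> q = p' \<oplus>\<^bsub>M\<^esub> q'" for p p' q q'
  proof -
    have c: "p \<in> carrier M" "p' \<in> carrier M" "q \<in> carrier M" "q' \<in> carrier M"
      using that subP subQ by auto
    have "p \<oplus>\<^bsub>M\<^esub> \<ominus>\<^bsub>M\<^esub> p' = (p \<oplus>\<^bsub>M\<^esub> q) \<oplus>\<^bsub>M\<^esub> (\<ominus>\<^bsub>M\<^esub> q \<oplus>\<^bsub>M\<^esub> \<ominus>\<^bsub>M\<^esub> p')"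
      using c by (simp add: M.a_assoc M.r_neg2)
    also have "\<dots> = q' \<oplus>\<^bsub>M\<^esub> \<ominus>\<^bsub>M\<^esub> q"
      unfolding that(5) using c
      by (simp add: M.a_assoc M.a_comm[of p' q'] M.a_comm[of "\<ominus>\<^bsub>M\<^esub> q" "\<ominus>\<^bsub>M\<^esub> p'"] M.r_neg2)
    finally have "p \<oplus>\<^bsub>M\<^esub> \<ominus>\<^bsub>M\<^esub> p' \<in> P \<inter> Q"
      using that M.submodule_add[OF P, of p "\<ominus>\<^bsub>M\<^esub> p'"] M.submodule_minus[OF P, of p']
        M.submodule_add[OF Q, of q' "\<ominus>\<^bsub>M\<^esub> q"] M.submodule_minus[OF Q, of q] by auto
    then have "p \<oplus>\<^bsub>M\<^esub> \<ominus>\<^bsub>M\<^esub> p' = \<zero>\<^bsub>M\<^esub>" using PQ by auto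
    then show ?thesis using c by (metis M.a_inv_closed M.minus_equality M.minus_minus M.add.inv_comm)
  qed
  \<comment> \<open>The projection onto \<open>P\<close> along \<open>Q\<close>.\<close>
  define e where "e = (\<lambda>x\<in>carrier M. SOME p. p \<in> P \<and> (\<exists>q\<in>Q. x = p \<oplus>\<^bsub>M\<^esub> q))"
  have e: "e (p \<oplus>\<^bsub>M\<^esub> q) = p" if "p \<in> P" "q \<in> Q" for p q
  proof -
    have "(SOME p'. p' \<in> P \<and> (\<exists>q'\<in>Q. p \<oplus>\<^bsub>M\<^esub> q = p' \<oplus>\<^bsub>M\<^esub> q')) = p"
      using that unique by (intro some_equality) blast+
    then show ?thesis using that subP subQ by (simp add: e_def)
  qed
  have eP: "e p = p" if "p \<in> P" for p
    using e[OF that M.submodule_zero[OF Q]] subP[OF that] by simp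
  have eQ: "e q = \<zero>\<^bsub>M\<^esub>" if "q \<in> Q" for q
    using e[OF M.submodule_zero[OF P] that] subQ[OF that] by simp
  have e_Hom: "e \<in> Hom R M M"
  proof (rule HomI)
    fix x assume x: "x \<in> carrier M"
    then obtain p q where pq: "p \<in> P" "q \<in> Q" "x = p \<oplus>\<^bsub>M\<^esub> q" using ex by blast
    then show "e x \<in> carrier M" using e subP by simp
    have "e (a \<odot>\<^bsub>M\<^esub> x) = e (a \<odot>\<^bsub>M\<^esub> p \<oplus>\<^bsub>M\<^esub> a \<odot>\<^bsub>M\<^esub> q)" if "a \<in> carrier R" for a
      using pq that subP subQ by (simp add: M.lsmult_r_distr)
    then show "e (a \<odot>\<^bsub>M\<^esub> x) = a \<odot>\<^bsub>M\<^esub> e x" if "a \<in> carrier R" for a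
      using pq that e M.submodule_smult[OF P] M.submodule_smult[OF Q] by simp
    fix y assume "y \<in> carrier M"
    then obtain p' q' where pq': "p' \<in> P" "q' \<in> Q" "y = p' \<oplus>\<^bsub>M\<^esub> q'" using ex by blast
    have "x \<oplus>\<^bsub>M\<^esub> y = (p \<oplus>\<^bsub>M\<^esub> p') \<oplus>\<^bsub>M\<^esub> (q \<oplus>\<^bsub>M\<^esub> q')"
      using pq pq' subP subQ by (simp add: M.a_ac)
    then show "e (x \<oplus>\<^bsub>M\<^esub> y) = e x \<oplus>\<^bsub>M\<^esub> e y"
      using pq pq' e M.submodule_add[OF P] M.submodule_add[OF Q] by simp
  qed (simp add: e_def)
  show "P = {\<zero>\<^bsub>M\<^esub>} \<or> Q = {\<zero>\<^bsub>M\<^esub>}"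
  proof (cases "e = \<zero>\<^bsub>end_ring R M\<^esub>")
    case True
    then have "p = \<zero>\<^bsub>M\<^esub>" if "p \<in> P" for p
      using eP[OF that] subP[OF that] by (simp add: end_ring_def)
    then show ?thesis using M.submodule_zero[OF P] by blast
  next
    case False
    have "e (e x) = e x" if x: "x \<in> carrier M" for x
    proof -
      obtain p q where pq: "p \<in> P" "q \<in> Q" "x = p \<oplus>\<^bsub>M\<^esub> q"
        using ex[OF x] by (elim bexE)
      show ?thesis unfolding pq(3) e[OF pq(1,2)] eP[OF pq(1)] ..
    qed
    then have "compose (carrier M) e e = e"
      using Hom_extensional[OF e_Hom]
      by (intro extensionalityI[of _ "carrier M"]) (simp_all add: compose_eq)
    then have "e = \<one>\<^bsub>end_ring R M\<^esub>"
      using E.nonzero_Units[of e] e_Hom False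
      by (intro E.idempotent_Unit) (simp_all add: end_ring_def)
    then have "q = \<zero>\<^bsub>M\<^esub>" if "q \<in> Q" for q
      using eQ[OF that] subQ[OF that] by (simp add: end_ring_def)
    then show ?thesis using M.submodule_zero[OF Q] by blast
  qed
qed

text \<open>
  Only the multiplicative structure has to be compared: zero is the absorbing element of the
  multiplicative monoid, so any isomorphism of monoids preserves it.  A fully faithful functor
  supplies such an isomorphism between endomorphism rings.
\<close>

lemma skew_field_transfer:
  assumes "skew_field E" "ring E'"
    and bij: "bij_betw \<Phi> (carrier E) (carrier E')"
    and one: "\<Phi> \<one>\<^bsub>E\<^esub> = \<one>\<^bsub>E'\<^esub>"
    and mult: "\<And>x y. \<lbrakk>x \<in> carrier E; y \<in> carrier E\<rbrakk> \<Longrightarrow> \<Phi> (x \<otimes>\<^bsub>E\<^esub> y) = \<Phi> x \<otimes>\<^bsub>E'\<^esub> \<Phi> y"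
  shows "skew_field E'"
proof -
  interpret E: skew_field E by fact
  interpret E': ring E' by fact
  have surj: "\<exists>x\<in>carrier E. y = \<Phi> x" if "y \<in> carrier E'" for y
    using that bij by (auto simp: bij_betw_def)
  have inj: "x = y" if "\<Phi> x = \<Phi> y" "x \<in> carrier E" "y \<in> carrier E" for x y
    using that bij by (auto simp: bij_betw_def inj_on_def)
  have cl: "\<Phi> x \<in> carrier E'" if "x \<in> carrier E" for x
    using that bij by (auto simp: bij_betw_def)
  \<comment> \<open>The absorbing property of zero, tested against the preimage \<open>z\<close> of zero.\<close>
  obtain z where z: "z \<in> carrier E" "\<zero>\<^bsub>E'\<^esub> = \<Phi> z" using surj[of "\<zero>\<^bsub>E'\<^esub>"] by auto
  have "\<Phi> \<zero>\<^bsub>E\<^esub> = \<Phi> \<zero>\<^bsub>E\<^esub> \<otimes>\<^bsub>E'\<^esub> \<zero>\<^bsub>E'\<^esub>"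
    using z mult[of "\<zero>\<^bsub>E\<^esub>" z] by simp
  also have "\<dots> = \<zero>\<^bsub>E'\<^esub>" using cl by simp
  finally have zero: "\<Phi> \<zero>\<^bsub>E\<^esub> = \<zero>\<^bsub>E'\<^esub>" .
  show ?thesis
  proof (intro skew_field.intro skew_field_axioms.intro E'.ring_axioms)
    show "\<one>\<^bsub>E'\<^esub> \<noteq> \<zero>\<^bsub>E'\<^esub>"
      using inj[of "\<one>\<^bsub>E\<^esub>" "\<zero>\<^bsub>E\<^esub>"] E.one_neq_zero by (auto simp: one zero)
    fix y assume "y \<in> carrier E' - {\<zero>\<^bsub>E'\<^esub>}"
    then obtain x where x: "x \<in> carrier E" "y = \<Phi> x" "x \<noteq> \<zero>\<^bsub>E\<^esub>" using surj zero by blast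
    then have "x \<in> Units E" using E.nonzero_Units by auto
    then have "\<Phi> (inv\<^bsub>E\<^esub> x) \<otimes>\<^bsub>E'\<^esub> \<Phi> x = \<one>\<^bsub>E'\<^esub>" "\<Phi> x \<otimes>\<^bsub>E'\<^esub> \<Phi> (inv\<^bsub>E\<^esub> x) = \<one>\<^bsub>E'\<^esub>"
      using x(1) by (simp_all add: one E.Units_l_inv E.Units_r_inv flip: mult)
    then show "y \<in> Units E'"
      using x cl \<open>x \<in> Units E\<close> by (auto simp: Units_def[of E'] intro!: bexI[of _ "\<Phi> (inv\<^bsub>E\<^esub> x)"])
  qed
qed

section \<open>Fully faithful functors\<close>

text \<open>
  The two inclusions make the notion cover both the functors on all modules and those on
  finite-dimensional modules.
\<close>

locale fully_faithful_functor = module_functor +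
  assumes fully_faithful: "fully_faithful R C S F"
    and source_modules: "C \<subseteq> all_modules R"
    and target_modules: "D \<subseteq> all_modules S"
begin

lemma left_module_source: "M \<in> C \<Longrightarrow> left_module R M"
  using source_modules by (auto simp: all_modules_def)

lemma left_module_obj: "M \<in> C \<Longrightarrow> left_module S (obj F M)"
  using target_modules obj_closed by (auto simp: all_modules_def)

lemma arr_bij:
  "\<lbrakk>M \<in> C; N \<in> C\<rbrakk> \<Longrightarrow> bij_betw (arr F M N) (Hom R M N) (Hom S (obj F M) (obj F N))"
  using fully_faithful by (auto simp: fully_faithful_def)

lemma arr_inj:
  "\<lbrakk>M \<in> C; N \<in> C; f \<in> Hom R M N; g \<in> Hom R M N; arr F M N f = arr F M N g\<rbrakk> \<Longrightarrow> f = g"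
  using arr_bij[of M N] by (auto simp: bij_betw_def inj_on_def)

lemma arr_surj:
  assumes "M \<in> C" "N \<in> C" "g \<in> Hom S (obj F M) (obj F N)"
  obtains f where "f \<in> Hom R M N" "arr F M N f = g"
proof -
  have "g \<in> arr F M N ` Hom R M N"
    using arr_bij[OF assms(1,2)] assms(3) by (simp add: bij_betw_def)
  then show ?thesis using that by blast
qed

text \<open>
  The inverse of the image of \<open>f\<close> is a homomorphism, hence the image of some \<open>g\<close> by fullness;
  by faithfulness \<open>g\<close> is inverse to \<open>f\<close>, since both composites are sent to identities.
\<close>

lemma arr_reflects_bij:
  assumes MN: "M \<in> C" "N \<in> C" and f: "f \<in> Hom R M N"
    and bij: "bij_betw (arr F M N f) (carrier (obj F M)) (carrier (obj F N))"
  shows "bij_betw f (carrier M) (carrier N)"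
proof -
  define h where "h = (\<lambda>y\<in>carrier (obj F N). inv_into (carrier (obj F M)) (arr F M N f) y)"
  have h: "h \<in> Hom S (obj F N) (obj F M)"
    unfolding h_def using left_module_obj[OF MN(1)] arr_closed[OF MN f] bij by (rule inverse_Hom)
  obtain g where g: "g \<in> Hom R N M" "arr F N M g = h"
    using arr_surj[OF MN(2,1) h] by blast
  note M = left_module_source[OF MN(1)] and N = left_module_source[OF MN(2)]
  have Ff: "arr F M N f x \<in> carrier (obj F N)" "h (arr F M N f x) = x" if "x \<in> carrier (obj F M)" for x
    using that bij by (auto simp: h_def bij_betw_def)
  have Fh: "h y \<in> carrier (obj F M)" "arr F M N f (h y) = y" if "y \<in> carrier (obj F N)" for y
    using that bij by (auto simp: h_def bij_betw_def inv_into_into f_inv_into_f)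
  have "arr F M M (compose (carrier M) g f) = arr F M M (\<lambda>x\<in>carrier M. x)"
    unfolding arr_comp[OF MN(1,2,1) f g(1)] arr_id[OF MN(1)] g(2)
    using Ff by (auto simp: compose_def)
  then have gf: "compose (carrier M) g f = (\<lambda>x\<in>carrier M. x)"
    by (intro arr_inj[OF MN(1,1)] compose_Hom[OF M f g(1)] identity_Hom M)
  have "arr F N N (compose (carrier N) f g) = arr F N N (\<lambda>x\<in>carrier N. x)"
    unfolding arr_comp[OF MN(2,1,2) g(1) f] arr_id[OF MN(2)] g(2)
    using Fh by (auto simp: compose_def)
  then have fg: "compose (carrier N) f g = (\<lambda>x\<in>carrier N. x)"
    by (intro arr_inj[OF MN(2,2)] compose_Hom[OF N g(1) f] identity_Hom N)
  show ?thesis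
  proof (rule bij_betw_byWitness[of _ g])
    show "\<forall>x\<in>carrier M. g (f x) = x" using fun_cong[OF gf] by (metis compose_eq restrict_apply')
    show "\<forall>y\<in>carrier N. f (g y) = y" using fun_cong[OF fg] by (metis compose_eq restrict_apply')
  qed (use Hom_closed[OF f] Hom_closed[OF g(1)] in auto)
qed

lemma reflects_isomorphic:
  assumes "M \<in> C" "N \<in> C" "isomorphic_modules S (obj F M) (obj F N)"
  shows "isomorphic_modules R M N"
proof -
  obtain g where g: "g \<in> Hom S (obj F M) (obj F N)"
      "bij_betw g (carrier (obj F M)) (carrier (obj F N))"
    using assms(3) by (auto simp: isomorphic_modules_def)
  obtain f where "f \<in> Hom R M N" "arr F M N f = g" using arr_surj[OF assms(1,2) g(1)] by blast
  then show ?thesis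
    using arr_reflects_bij[OF assms(1,2), of f] g(2) by (auto simp: isomorphic_modules_def)
qed

lemma brick_obj:
  assumes "M \<in> C" "brick R M"
  shows "brick S (obj F M)"
proof -
  have "skew_field (end_ring S (obj F M))"
  proof (rule skew_field_transfer[where E = "end_ring R M" and \<Phi> = "arr F M M"])
    show "skew_field (end_ring R M)" using assms by (simp add: brick_def)
    show "ring (end_ring S (obj F M))" by (intro ring_end_ring left_module_obj assms)
  qed (use assms(1) arr_bij arr_id arr_comp in \<open>auto simp: end_ring_def\<close>)
  then show ?thesis using left_module_obj[OF assms(1)] by (simp add: brick_def)
qed

end

section \<open>Images of modules under maps of sets\<close>

text \<open>
  A map \<open>q\<close> on the carrier of a module whose fibres are compatible with the operations induces
  a module structure on its image.  The operations are computed on chosen preimages.  Taking a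
  choice of coset representatives for \<open>q\<close> gives quotients that stay in the same universe; taking
  an injection into another type moves a module to another universe.
\<close>

definition image_module :: "('p \<Rightarrow> 'm) \<Rightarrow> ('a, 'p) module \<Rightarrow> ('a, 'm) module" where
  "image_module q P =
    (let s = inv_into (carrier P) q in
     \<lparr>carrier = q ` carrier P, monoid.mult = undefined, one = undefined, zero = q \<zero>\<^bsub>P\<^esub>,
      add = (\<lambda>x y. q (s x \<oplus>\<^bsub>P\<^esub> s y)), smult = (\<lambda>a x. q (a \<odot>\<^bsub>P\<^esub> s x))\<rparr>)"

lemma
  assumes P: "left_module R P"
    and cong_add: "\<And>x x' y y'. \<lbrakk>x \<in> carrier P; x' \<in> carrier P; y \<in> carrier P; y' \<in> carrier P;
        q x = q x'; q y = q y'\<rbrakk> \<Longrightarrow> q (x \<oplus>\<^bsub>P\<^esub> y) = q (x' \<oplus>\<^bsub>P\<^esub> y')"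
    and cong_smult: "\<And>a x x'. \<lbrakk>a \<in> carrier R; x \<in> carrier P; x' \<in> carrier P; q x = q x'\<rbrakk>
        \<Longrightarrow> q (a \<odot>\<^bsub>P\<^esub> x) = q (a \<odot>\<^bsub>P\<^esub> x')"
  shows left_module_image_module: "left_module R (image_module q P)"
    and image_module_Hom: "(\<lambda>x\<in>carrier P. q x) \<in> Hom R P (image_module q P)"
proof -
  interpret P: left_module R P by fact
  let ?Q = "image_module q P"
  have carr: "carrier ?Q = q ` carrier P" and zero: "\<zero>\<^bsub>?Q\<^esub> = q \<zero>\<^bsub>P\<^esub>"
    by (simp_all add: image_module_def Let_def)
  have s: "inv_into (carrier P) q (q x) \<in> carrier P" "q (inv_into (carrier P) q (q x)) = q x"
    if "x \<in> carrier P" for x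
    using that by (auto intro: inv_into_into f_inv_into_f)
  have add: "q x \<oplus>\<^bsub>?Q\<^esub> q y = q (x \<oplus>\<^bsub>P\<^esub> y)" if "x \<in> carrier P" "y \<in> carrier P" for x y
    using that s by (auto simp: image_module_def Let_def intro!: cong_add)
  have smult: "a \<odot>\<^bsub>?Q\<^esub> q x = q (a \<odot>\<^bsub>P\<^esub> x)" if "a \<in> carrier R" "x \<in> carrier P" for a x
    using that s by (auto simp: image_module_def Let_def intro!: cong_smult)
  show "(\<lambda>x\<in>carrier P. q x) \<in> Hom R P ?Q"
    by (rule HomI) (simp_all add: carr add smult P.lsmult_closed)
  have "abelian_group ?Q"
  proof (rule abelian_groupI)
    fix y assume "y \<in> carrier ?Q"
    then obtain x where x: "x \<in> carrier P" "y = q x" by (auto simp: carr)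
    then show "\<exists>y'\<in>carrier ?Q. y' \<oplus>\<^bsub>?Q\<^esub> y = \<zero>\<^bsub>?Q\<^esub>"
      by (intro bexI[of _ "q (\<ominus>\<^bsub>P\<^esub> x)"]) (simp_all add: carr zero add P.l_neg)
  qed (auto simp: carr zero add P.a_assoc intro!: P.a_comm arg_cong[of _ _ q])
  then show "left_module R ?Q"
    by (intro left_module.intro left_module_axioms.intro P.R.ring_axioms)
      (auto simp: carr add smult P.lsmult_closed P.lsmult_l_distr P.lsmult_r_distr
        P.lsmult_assoc P.lsmult_one)
qed

lemma carrier_image_module: "carrier (image_module q P) = q ` carrier P"
  by (simp add: image_module_def Let_def)

text \<open>
  The quotient has to be a module in the universe of \<open>M\<close>, hence cosets are replaced by
  representatives.
\<close>

lemma quotient_module: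
  fixes M :: "('a, 'm) module"
  assumes M: "left_module R M" and N: "Module.submodule N R M"
  obtains Q :: "('a, 'm) module" and g where "left_module R Q" "g \<in> Hom R M Q"
    "g ` carrier M = carrier Q" "{x \<in> carrier M. g x = \<zero>\<^bsub>Q\<^esub>} = N"
proof -
  interpret M: left_module R M by fact
  note sub = subsetD[OF M.submodule_subset[OF N]]
  define r where "r x y \<longleftrightarrow> x \<oplus>\<^bsub>M\<^esub> \<ominus>\<^bsub>M\<^esub> y \<in> N" for x y
  have refl: "r x x" if "x \<in> carrier M" for x
    using that M.submodule_zero[OF N] by (simp add: r_def M.r_neg)
  have sym: "r y x" if "r x y" "x \<in> carrier M" "y \<in> carrier M" for x y
    using that M.submodule_minus[OF N, of "x \<oplus>\<^bsub>M\<^esub> \<ominus>\<^bsub>M\<^esub> y"]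
    by (simp add: r_def M.minus_add M.a_comm)
  have trans: "r x z" if "r x y" "r y z" "x \<in> carrier M" "y \<in> carrier M" "z \<in> carrier M" for x y z
    using that M.submodule_add[OF N, of "x \<oplus>\<^bsub>M\<^esub> \<ominus>\<^bsub>M\<^esub> y" "y \<oplus>\<^bsub>M\<^esub> \<ominus>\<^bsub>M\<^esub> z"]
    by (simp add: r_def M.a_assoc M.r_neg1)
  have r_add: "r (x \<oplus>\<^bsub>M\<^esub> y) (x' \<oplus>\<^bsub>M\<^esub> y')" if "r x x'" "r y y'"
    "x \<in> carrier M" "y \<in> carrier M" "x' \<in> carrier M" "y' \<in> carrier M" for x y x' y'
    using that M.submodule_add[OF N, of "x \<oplus>\<^bsub>M\<^esub> \<ominus>\<^bsub>M\<^esub> x'" "y \<oplus>\<^bsub>M\<^esub> \<ominus>\<^bsub>M\<^esub> y'"]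
    by (simp add: r_def M.minus_add M.a_ac)
  have r_smult: "r (a \<odot>\<^bsub>M\<^esub> x) (a \<odot>\<^bsub>M\<^esub> x')" if "r x x'"
    "a \<in> carrier R" "x \<in> carrier M" "x' \<in> carrier M" for a x x'
    using that M.submodule_smult[OF N, of a "x \<oplus>\<^bsub>M\<^esub> \<ominus>\<^bsub>M\<^esub> x'"]
    by (simp add: r_def M.lsmult_r_distr M.lsmult_minus)
  define q where "q x = (SOME y. y \<in> carrier M \<and> r x y)" for x
  have q: "q x \<in> carrier M" "r x (q x)" if "x \<in> carrier M" for x
    using someI[of "\<lambda>y. y \<in> carrier M \<and> r x y" x] that refl by (auto simp: q_def)
  have q_eq: "q x = q x' \<longleftrightarrow> r x x'" if xx': "x \<in> carrier M" "x' \<in> carrier M" for x x'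
  proof
    assume "q x = q x'"
    then show "r x x'" using q[OF xx'(1)] q[OF xx'(2)] sym trans xx' by metis
  next
    assume "r x x'"
    then have "(\<lambda>y. y \<in> carrier M \<and> r x y) = (\<lambda>y. y \<in> carrier M \<and> r x' y)"
      using xx' sym trans by blast
    then show "q x = q x'" unfolding q_def by (rule arg_cong)
  qed
  have cong: "\<lbrakk>x \<in> carrier M; x' \<in> carrier M; y \<in> carrier M; y' \<in> carrier M;
        q x = q x'; q y = q y'\<rbrakk> \<Longrightarrow> q (x \<oplus>\<^bsub>M\<^esub> y) = q (x' \<oplus>\<^bsub>M\<^esub> y')"
    "\<lbrakk>a \<in> carrier R; x \<in> carrier M; x' \<in> carrier M; q x = q x'\<rbrakk>
        \<Longrightarrow> q (a \<odot>\<^bsub>M\<^esub> x) = q (a \<odot>\<^bsub>M\<^esub> x')" for a x x' y y'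
    using r_add r_smult by (simp_all add: q_eq M.lsmult_closed)
  show ?thesis
  proof (rule that)
    show "left_module R (image_module q M)"
      using M cong by (rule left_module_image_module)
    show "(\<lambda>x\<in>carrier M. q x) \<in> Hom R M (image_module q M)"
      using M cong by (rule image_module_Hom)
    show "(\<lambda>x\<in>carrier M. q x) ` carrier M = carrier (image_module q M)"
      by (auto simp: carrier_image_module)
    have "(x \<in> carrier M \<and> q x = q \<zero>\<^bsub>M\<^esub>) \<longleftrightarrow> x \<in> N" for x
      using q_eq[of x "\<zero>\<^bsub>M\<^esub>"] sub[of x] M.minus_equality[of "\<zero>\<^bsub>M\<^esub>" "\<zero>\<^bsub>M\<^esub>"]
      by (auto simp: r_def)
    then show "{x \<in> carrier M. (\<lambda>x\<in>carrier M. q x) x = \<zero>\<^bsub>image_module q M\<^esub>} = N"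
      by (auto simp: image_module_def Let_def)
  qed
qed

section \<open>Length and generic bricks under exact functors\<close>

lemma exact_functorD:
  assumes "exact_functor R C S F" "L \<in> C" "M \<in> C" "N \<in> C" "short_exact R L M N f g"
  shows "short_exact S (obj F L) (obj F M) (obj F N) (arr F L M f) (arr F M N g)"
  using assms(1)[unfolded exact_functor_def, rule_format, OF assms(2-5)] .

text \<open>
  An inclusion of a submodule is the left part of a short exact sequence that ends in the quotient,
  so an exact functor keeps it injective.
\<close>

lemma exact_functor_mono:
  fixes M :: "('a, 'm) module"
  assumes F: "exact_functor R (all_modules R) S F"
    and M: "left_module R M" and N: "Module.submodule N R M"
  shows "inj_on (arr F (M\<lparr>carrier := N\<rparr>) M (\<lambda>x\<in>N. x)) (carrier (obj F (M\<lparr>carrier := N\<rparr>)))"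
proof -
  obtain Q :: "('a, 'm) module" and g where Q: "left_module R Q" "g \<in> Hom R M Q"
    "g ` carrier M = carrier Q" "{x \<in> carrier M. g x = \<zero>\<^bsub>Q\<^esub>} = N"
    by (rule quotient_module[OF M N])
  have "short_exact R (M\<lparr>carrier := N\<rparr>) M Q (\<lambda>x\<in>N. x) g"
    using short_exact_kernel[OF M Q(1-3)] by (simp add: Q(4))
  moreover have "M\<lparr>carrier := N\<rparr> \<in> all_modules R" "M \<in> all_modules R" "Q \<in> all_modules R"
    using M Q(1) left_module.left_module_submodule[OF M N] by (simp_all add: all_modules_def)
  ultimately have "short_exact S (obj F (M\<lparr>carrier := N\<rparr>)) (obj F M) (obj F Q)
      (arr F (M\<lparr>carrier := N\<rparr>) M (\<lambda>x\<in>N. x)) (arr F M Q g)"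
    by (intro exact_functorD[OF F])
  then show ?thesis by (simp add: short_exact_def)
qed

text \<open>
  A strict chain of submodules of \<open>M\<close> is sent to a strict chain of submodules of its image:
  applying the functor to the inclusion of \<open>N\<close> gives a submodule \<open>I N\<close>, and if \<open>I N = I N'\<close> for
  \<open>N \<subseteq> N'\<close>, then the functor makes the inclusion of \<open>N\<close> in \<open>N'\<close> bijective, so that this inclusion
  is itself bijective.
\<close>

lemma module_length_le:
  assumes F: "fully_faithful_functor R (all_modules R) S (all_modules S) F"
    and exact: "exact_functor R (all_modules R) S F"
    and M: "left_module R M"
  shows "module_length R M \<le> module_length S (obj F M)"
proof -
  interpret fully_faithful_functor R "all_modules R" S "all_modules S" F by fact
  define \<iota> where "\<iota> N = arr F (M\<lparr>carrier := N\<rparr>) M (\<lambda>x\<in>N. x)" for N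
  define I where "I N = \<iota> N ` carrier (obj F (M\<lparr>carrier := N\<rparr>))" for N
  have MC: "M \<in> all_modules R" using M by (simp add: all_modules_def)
  have NC: "M\<lparr>carrier := N\<rparr> \<in> all_modules R" if "Module.submodule N R M" for N
    using left_module.left_module_submodule[OF M that] by (simp add: all_modules_def)
  have incl: "(\<lambda>x\<in>N. x) \<in> Hom R (M\<lparr>carrier := N\<rparr>) M" if "Module.submodule N R M" for N
    using inclusion_Hom[OF M that left_module.submodule_subset[OF M that]] by simp
  have I_sub: "Module.submodule (I N) S (obj F M)" if N: "Module.submodule N R M" for N
    unfolding I_def \<iota>_def
    by (intro submodule_image left_module_obj arr_closed incl NC MC N)
  have I_strict: "I N \<subset> I N'"
    if N: "Module.submodule N R M" and N': "Module.submodule N' R M" and "N \<subset> N'" for N N'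
  proof -
    define j where "j = arr F (M\<lparr>carrier := N\<rparr>) (M\<lparr>carrier := N'\<rparr>) (\<lambda>x\<in>N. x)"
    have j0: "(\<lambda>x\<in>N. x) \<in> Hom R (M\<lparr>carrier := N\<rparr>) (M\<lparr>carrier := N'\<rparr>)"
      using \<open>N \<subset> N'\<close> by (intro inclusion_Hom[OF M N]) auto
    have j: "j y \<in> carrier (obj F (M\<lparr>carrier := N'\<rparr>))" if "y \<in> carrier (obj F (M\<lparr>carrier := N\<rparr>))" for y
      unfolding j_def using arr_closed[OF NC[OF N] NC[OF N'] j0] that by (rule Hom_closed)
    have "(\<lambda>x\<in>N. x) = compose (carrier (M\<lparr>carrier := N\<rparr>)) (\<lambda>x\<in>N'. x) (\<lambda>x\<in>N. x)"
      using \<open>N \<subset> N'\<close> unfolding compose_def by (intro ext) auto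
    then have comp: "\<iota> N y = \<iota> N' (j y)" if "y \<in> carrier (obj F (M\<lparr>carrier := N\<rparr>))" for y
      using arr_comp[OF NC[OF N] NC[OF N'] MC j0 incl[OF N']] that
      by (simp add: \<iota>_def j_def compose_eq)
    have inj: "inj_on (\<iota> N) (carrier (obj F (M\<lparr>carrier := N\<rparr>)))"
      "inj_on (\<iota> N') (carrier (obj F (M\<lparr>carrier := N'\<rparr>)))"
      unfolding \<iota>_def by (intro exact_functor_mono[OF exact M] N N')+
    have "I N \<subseteq> I N'" unfolding I_def using comp j by auto
    moreover have "I N \<noteq> I N'"
    proof
      assume eq: "I N = I N'"
      have "inj_on j (carrier (obj F (M\<lparr>carrier := N\<rparr>)))"
        using inj(1) comp by (metis (no_types, lifting) inj_on_def)
      moreover have "y \<in> j ` carrier (obj F (M\<lparr>carrier := N\<rparr>))"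
        if y: "y \<in> carrier (obj F (M\<lparr>carrier := N'\<rparr>))" for y
      proof -
        have "\<iota> N' y \<in> I N" using y eq by (simp add: I_def)
        then obtain x where x: "x \<in> carrier (obj F (M\<lparr>carrier := N\<rparr>))" "\<iota> N' y = \<iota> N x"
          by (auto simp: I_def)
        then have "y = j x" using inj(2) y comp j by (auto simp: inj_on_def)
        then show ?thesis using x by auto
      qed
      ultimately have "bij_betw j (carrier (obj F (M\<lparr>carrier := N\<rparr>))) (carrier (obj F (M\<lparr>carrier := N'\<rparr>)))"
        using j by (auto simp: bij_betw_def)
      then have "bij_betw (\<lambda>x\<in>N. x) (carrier (M\<lparr>carrier := N\<rparr>)) (carrier (M\<lparr>carrier := N'\<rparr>))"
        unfolding j_def by (rule arr_reflects_bij[OF NC[OF N] NC[OF N'] j0])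
      then show False using \<open>N \<subset> N'\<close> by (auto simp: bij_betw_def)
    qed
    ultimately show ?thesis by auto
  qed
  have chain: "\<exists>N'. (\<forall>i\<le>n. Module.submodule (N' i) S (obj F M)) \<and> (\<forall>i<n. N' i \<subset> N' (Suc i))"
    if "\<forall>i\<le>n. Module.submodule (N i) R M" "\<forall>i<n. N i \<subset> N (Suc i)" for n and N :: "nat \<Rightarrow> _"
    using that I_sub I_strict by (intro exI[of _ "\<lambda>i. I (N i)"]) auto
  show ?thesis
    unfolding module_length_def
  proof (rule Sup_subset_mono, rule subsetI, elim CollectE exE conjE)
    fix e n and N :: "nat \<Rightarrow> _"
    assume "e = enat n" "\<forall>i\<le>n. Module.submodule (N i) R M" "\<forall>i<n. N i \<subset> N (Suc i)"
    with chain[of n N] show "e \<in> {enat n | n. \<exists>N. (\<forall>i\<le>n. Module.submodule (N i) S (obj F M))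
        \<and> (\<forall>i<n. N i \<subset> N (Suc i))}"
      by (intro CollectI exI[of _ n] conjI)
  qed
qed

text \<open>
  The second half of the theorem: the image is a brick by full faithfulness, therefore
  indecomposable, and has infinite length because lengths do not decrease.
\<close>

lemma generic_brick_obj:
  assumes F: "fully_faithful_functor R (all_modules R) S (all_modules S) F"
    and exact: "exact_functor R (all_modules R) S F"
    and M: "generic_brick R M" and fin: "endofinite S (obj F M)"
  shows "generic_brick S (obj F M)"
proof -
  interpret fully_faithful_functor R "all_modules R" S "all_modules S" F by fact
  have M': "left_module R M" "brick R M" "module_length R M = \<infinity>"
    using M by (auto simp: generic_brick_def generic_module_def)
  then have "brick S (obj F M)" by (intro brick_obj) (auto simp: all_modules_def)
  moreover have "module_length S (obj F M) = \<infinity>"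
    using module_length_le[OF F exact M'(1)] M'(3) by simp
  moreover have "indecomposable_module S (obj F M)"
    using \<open>brick S (obj F M)\<close> by (rule brick_indecomposable)
  ultimately show ?thesis
    using fin by (simp add: generic_brick_def generic_module_def brick_def)
qed

section \<open>Algebraically closed fields are infinite, and powers of infinite sets\<close>

text \<open>
  If the field were finite, then one plus the product of \<open>X - a\<close> over all its elements \<open>a\<close>
  would take the value one everywhere and be a polynomial of positive degree without a root.
\<close>

lemma (in algebraically_closed) infinite_carrier: "infinite (carrier L)"
proof
  assume fin: "finite (carrier L)"
  have "\<exists>p. polynomial (carrier L) p \<and> p \<noteq> [] \<and> degree p = card S \<and> (\<forall>a\<in>S. eval p a = \<zero>)"
    if "finite S" "S \<subseteq> carrier L" for S
    using that
  proof (induction S)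
    case empty
    then show ?case
      using one_is_polynomial[OF carrier_is_subring] by (intro exI[of _ "[\<one>]"]) auto
  next
    case (insert a S)
    then obtain p where p: "polynomial (carrier L) p" "p \<noteq> []" "degree p = card S"
      "\<And>b. b \<in> S \<Longrightarrow> eval p b = \<zero>" by blast
    have a: "a \<in> carrier L" using insert by simp
    let ?l = "[\<one>, \<ominus> a]"
    have l: "polynomial (carrier L) ?l" using a by (simp add: polynomial_def)
    have "length p = Suc (card S)" using p(2,3) by (cases p) auto
    then have deg: "degree (poly_mult p ?l) = card (insert a S)"
      using poly_mult_degree_eq[OF carrier_is_subring p(1) l] p(2) insert.hyps by simp
    have "eval (poly_mult p ?l) b = \<zero>" if "b \<in> insert a S" for b
    proof -
      have b: "b \<in> carrier L" using that insert.prems by auto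
      have "eval (poly_mult p ?l) b = eval p b \<otimes> eval ?l b"
        using polynomial_incl[OF p(1)] polynomial_incl[OF l] b by (rule eval_poly_mult)
      moreover have "eval p b = \<zero> \<or> eval ?l b = \<zero>"
        using that p(4) b by (auto simp: r_neg)
      ultimately show ?thesis
        using eval_in_carrier[OF polynomial_incl[OF p(1)] b]
          eval_in_carrier[OF polynomial_incl[OF l] b] by auto
    qed
    moreover have "poly_mult p ?l \<noteq> []"
      using deg insert.hyps by (intro notI) simp
    ultimately show ?case
      using poly_mult_is_polynomial[OF carrier_is_subring polynomial_incl[OF p(1)] polynomial_incl[OF l]] deg by blast
  qed
  from this[OF fin] obtain p where p: "polynomial (carrier L) p" "degree p = card (carrier L)"
    "\<And>a. a \<in> carrier L \<Longrightarrow> eval p a = \<zero>" by blast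
  have one: "polynomial (carrier L) [\<one>]" using one_is_polynomial[OF carrier_is_subring] .
  let ?q = "poly_add p [\<one>]"
  have pos: "card (carrier L) > 0" using fin zero_closed by (auto simp: card_gt_0_iff)
  have q: "polynomial (carrier L) ?q"
    using poly_add_is_polynomial[OF carrier_is_subring polynomial_incl[OF p(1)] polynomial_incl[OF one]] .
  have "degree ?q = card (carrier L)"
    using poly_add_degree_eq[OF carrier_is_subring p(1) one] p(2) pos by simp
  then have "size (roots ?q) > 0"
    using roots_over_carrier[of ?q] q pos by (simp add: splitted_def univ_poly_carrier)
  then obtain x where "x \<in># roots ?q" by (metis multiset_nonemptyE size_empty less_irrefl)
  then have x: "x \<in> carrier L" "eval ?q x = \<zero>"
    using roots_mem_iff_is_root[of ?q x] q by (simp_all add: is_root_def univ_poly_carrier)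
  have "eval ?q x = eval p x \<oplus> eval [\<one>] x"
    using polynomial_incl[OF p(1)] polynomial_incl[OF one] x(1) by (rule eval_poly_add)
  then show False using x p(3) by simp
qed

text \<open>
  A finite power of an infinite set is no larger than the set, by induction on the exponent from
  \<open>|C \<times> C| = |C|\<close>.
\<close>

lemma PiE_embeds_in_infinite:
  fixes C :: "'c set"
  assumes C: "infinite C" and "finite I" and g: "inj_on g Y" "g ` Y \<subseteq> C"
  shows "\<exists>h. inj_on h (I \<rightarrow>\<^sub>E Y) \<and> h ` (I \<rightarrow>\<^sub>E Y) \<subseteq> C"
  using assms(2)
proof (induction I)
  case empty
  obtain c where "c \<in> C" using C by (metis finite.emptyI ex_in_conv)
  then show ?case by (intro exI[of _ "\<lambda>_. c"]) auto
next
  case (insert i I)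
  then obtain h where h: "inj_on h (I \<rightarrow>\<^sub>E Y)" "h ` (I \<rightarrow>\<^sub>E Y) \<subseteq> C" by blast
  obtain p where p: "bij_betw p (C \<times> C) C"
    using card_of_Times_same_infinite[OF C] by (auto simp flip: card_of_ordIso)
  define k where "k f = p (g (f i), h (restrict f I))" for f
  have mem: "(g (f i), h (restrict f I)) \<in> C \<times> C" if "f \<in> insert i I \<rightarrow>\<^sub>E Y" for f
  proof -
    have "f i \<in> Y" "restrict f I \<in> I \<rightarrow>\<^sub>E Y" using that by auto
    then show ?thesis using g h by blast
  qed
  have "f = f'" if f: "f \<in> insert i I \<rightarrow>\<^sub>E Y" and f': "f' \<in> insert i I \<rightarrow>\<^sub>E Y" and eq: "k f = k f'" for f f'
  proof -
    have "(g (f i), h (restrict f I)) = (g (f' i), h (restrict f' I))"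
      using eq mem[OF f] mem[OF f'] p unfolding k_def bij_betw_def by (meson inj_onD)
    moreover have "f i \<in> Y" "restrict f I \<in> I \<rightarrow>\<^sub>E Y" "f' i \<in> Y" "restrict f' I \<in> I \<rightarrow>\<^sub>E Y"
      using f f' by auto
    ultimately have "f i = f' i" and r: "restrict f I = restrict f' I"
      using g(1) h(1) by (auto simp: inj_on_def)
    have "f j = f' j" if "j \<in> I" for j using fun_cong[OF r, of j] that by simp
    with \<open>f i = f' i\<close> show ?thesis using f f' by (intro PiE_ext) auto
  qed
  then have "inj_on k (insert i I \<rightarrow>\<^sub>E Y)" by (auto intro: inj_onI)
  moreover have "k ` (insert i I \<rightarrow>\<^sub>E Y) \<subseteq> C"
    using mem p by (auto simp: k_def bij_betw_def)
  ultimately show ?case by blast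
qed

section \<open>Finite-dimensional modules\<close>

text \<open>
  A maximal linearly independent subset of the subspace exists, since the dimension of the whole
  space bounds the size of such subsets, and it is a basis of the subspace.
\<close>

lemma (in vectorspace) fin_dim_subspace:
  assumes "fin_dim" "LinearCombinations.submodule K W V"
  shows "vectorspace.fin_dim K (vs W)"
proof -
  have "subspace K W V" using assms(2) vectorspace_axioms by (intro subspace.intro)
  then interpret W: vectorspace K "vs W" by (rule subspace_is_vs)
  let ?P = "\<lambda>S. S \<subseteq> carrier (vs W) \<and> W.lin_indpt S"
  have "finite S \<and> card S \<le> dim" if "?P S" for S
  proof -
    have "lin_indpt S" using that span_li_not_depend(2)[OF _ assms(2), of S] by simp
    moreover have "S \<subseteq> carrier V" using that assms(2) by (auto simp: LinearCombinations.submodule_def)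
    ultimately show ?thesis using li_le_dim[OF assms(1)] by blast
  qed
  moreover have "?P {}" by (auto simp: W.lin_dep_def)
  ultimately obtain B where "finite B" "maximal B ?P"
    using maximal_exists[of ?P dim "{}"] by blast
  then have "W.basis B" using W.max_li_is_basis by blast
  then show ?thesis using \<open>finite B\<close> by (auto simp: W.fin_dim_def W.basis_def)
qed

lemma carrier_underlying_vs [simp]: "carrier (underlying_vs A M) = carrier M"
  and add_underlying_vs [simp]: "add (underlying_vs A M) = add M"
  and zero_underlying_vs [simp]: "zero (underlying_vs A M) = zero M"
  and smult_underlying_vs [simp]: "c \<odot>\<^bsub>underlying_vs A M\<^esub> x = (c \<odot>\<^bsub>A\<^esub> \<one>\<^bsub>A\<^esub>) \<odot>\<^bsub>M\<^esub> x"
  and underlying_vs_submodule: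
    "underlying_vs A (M\<lparr>carrier := N\<rparr>) = (underlying_vs A M)\<lparr>carrier := N\<rparr>"
  by (simp_all add: underlying_vs_def)

text \<open>
  The algebra is a record without further fields here, which is what the underlying vector space of
  a module and the category of finite-dimensional modules are defined for.
\<close>

locale plain_fd_algebra = fd_algebra K A
  for K :: "('k, 'c) ring_scheme" and A :: "('k, 'a) module" (structure)
begin

lemma scalar_mult: "\<lbrakk>c \<in> carrier K; a \<in> carrier A\<rbrakk> \<Longrightarrow> (c \<odot>\<^bsub>A\<^esub> \<one>\<^bsub>A\<^esub>) \<otimes>\<^bsub>A\<^esub> a = c \<odot>\<^bsub>A\<^esub> a"
  using smult_mult_left[of c "\<one>\<^bsub>A\<^esub>" a] by simp

lemma underlying_vs_vectorspace:
  assumes "left_module A M"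
  shows "vectorspace K (underlying_vs A M)"
proof -
  interpret M: left_module A M by fact
  show ?thesis
  proof (rule vs_criteria)
    show "field K" by (rule field_axioms)
    show "\<forall>v\<in>carrier (underlying_vs A M). \<exists>w\<in>carrier (underlying_vs A M).
        v \<oplus>\<^bsub>underlying_vs A M\<^esub> w = \<zero>\<^bsub>underlying_vs A M\<^esub>"
      using M.r_neg M.a_inv_closed by auto
    show "\<forall>a b v. a \<in> carrier K \<and> b \<in> carrier K \<and> v \<in> carrier (underlying_vs A M) \<longrightarrow>
        (a \<otimes>\<^bsub>K\<^esub> b) \<odot>\<^bsub>underlying_vs A M\<^esub> v = a \<odot>\<^bsub>underlying_vs A M\<^esub> (b \<odot>\<^bsub>underlying_vs A M\<^esub> v)"
      using scalar_mult by (auto simp: smult_assoc1 simp flip: M.lsmult_assoc)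
    show "\<forall>v\<in>carrier (underlying_vs A M). \<one>\<^bsub>K\<^esub> \<odot>\<^bsub>underlying_vs A M\<^esub> v = v"
      by (auto simp: M.lsmult_one)
    show "\<forall>a b v. a \<in> carrier K \<and> b \<in> carrier K \<and> v \<in> carrier (underlying_vs A M) \<longrightarrow>
        (a \<oplus>\<^bsub>K\<^esub> b) \<odot>\<^bsub>underlying_vs A M\<^esub> v
          = a \<odot>\<^bsub>underlying_vs A M\<^esub> v \<oplus>\<^bsub>underlying_vs A M\<^esub> b \<odot>\<^bsub>underlying_vs A M\<^esub> v"
      by (auto simp: smult_l_distr simp flip: M.lsmult_l_distr)
  qed (auto simp: M.lsmult_closed M.a_assoc M.lsmult_r_distr intro: M.a_comm)
qed

lemma Hom_linear_map:
  assumes "left_module A M" "left_module A N" "f \<in> Hom A M N"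
  shows "linear_map K (underlying_vs A M) (underlying_vs A N) f"
proof -
  interpret M: vectorspace K "underlying_vs A M" using assms(1) by (rule underlying_vs_vectorspace)
  interpret N: vectorspace K "underlying_vs A N" using assms(2) by (rule underlying_vs_vectorspace)
  have "f \<in> LinearCombinations.module_hom K (underlying_vs A M) (underlying_vs A N)"
    using Hom_closed[OF assms(3)] Hom_add[OF assms(3)] Hom_smult[OF assms(3)]
    by (auto simp: module_hom_def)
  then show ?thesis by (intro_locales) (simp add: mod_hom_axioms_def)
qed

lemma
  assumes M: "M \<in> fd_modules K A" and N: "left_module A N"
    and f: "f \<in> Hom A M N" "f ` carrier M = carrier N"
  shows fd_modules_image: "N \<in> fd_modules K A"
    and fd_dim_image_le: "fd_dim K A N \<le> fd_dim K A M"
proof -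
  have M': "left_module A M" "vectorspace.fin_dim K (underlying_vs A M)"
    using M by (auto simp: fd_modules_def)
  interpret f: linear_map K "underlying_vs A M" "underlying_vs A N" f
    using M'(1) N f(1) by (rule Hom_linear_map)
  show "N \<in> fd_modules K A"
    using f.surj_fin_dim[OF M'(2)] f(2) N by (simp add: fd_modules_def)
  have "f.im = carrier N" using f(2) by (simp add: f.im_def)
  moreover have "(underlying_vs A N)\<lparr>carrier := carrier N\<rparr> = underlying_vs A N"
    by (simp add: underlying_vs_def)
  ultimately show "fd_dim K A N \<le> fd_dim K A M"
    using f.rank_nullity[OF M'(2)] unfolding fd_dim_def by (metis le_add1)
qed

lemma fd_modules_submodule:
  assumes M: "M \<in> fd_modules K A" and N: "Module.submodule N A M"
  shows "M\<lparr>carrier := N\<rparr> \<in> fd_modules K A"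
proof -
  have M': "left_module A M" "vectorspace.fin_dim K (underlying_vs A M)"
    using M by (auto simp: fd_modules_def)
  interpret V: vectorspace K "underlying_vs A M" using M'(1) by (rule underlying_vs_vectorspace)
  note sub = left_module.submodule_subset[OF M'(1) N] left_module.submodule_zero[OF M'(1) N]
    left_module.submodule_add[OF M'(1) N] left_module.submodule_smult[OF M'(1) N]
  have "LinearCombinations.submodule K N (underlying_vs A M)"
    using sub V.module_axioms by (intro LinearCombinations.submodule.intro) auto
  then show ?thesis
    using V.fin_dim_subspace[OF M'(2)] left_module.left_module_submodule[OF M'(1) N]
    by (simp add: fd_modules_def underlying_vs_submodule)
qed

end

section \<open>Free modules\<close>

text \<open>
  The functions from \<open>I\<close> to a ring form the free left module on \<open>I\<close> when \<open>I\<close> is finite.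
\<close>

lemma left_module_func_space:
  assumes "ring R"
  shows "left_module R (ring.func_space R I)"
proof -
  interpret R: ring R by fact
  have eqI: "f = g" if "f \<in> extensional I" "g \<in> extensional I" "\<And>i. i \<in> I \<Longrightarrow> f i = g i" for f g
    using that by (rule extensionalityI)
  have mem: "f i \<in> carrier R" if "f \<in> I \<rightarrow>\<^sub>E carrier R" "i \<in> I" for f i
    using that by auto
  have ext: "f \<in> extensional I" if "f \<in> I \<rightarrow>\<^sub>E carrier R" for f
    using that by (simp add: PiE_def)
  have "abelian_group (R.func_space I)"
  proof (rule abelian_groupI)
    fix f assume "f \<in> carrier (R.func_space I)"
    then show "\<exists>g\<in>carrier (R.func_space I). g \<oplus>\<^bsub>R.func_space I\<^esub> f = \<zero>\<^bsub>R.func_space I\<^esub>"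
      by (intro bexI[of _ "\<lambda>i\<in>I. \<ominus>\<^bsub>R\<^esub> f i"]) (auto simp: R.func_space_def R.l_neg mem ext intro!: eqI)
  qed (auto simp: R.func_space_def R.a_assoc mem ext intro!: eqI R.a_comm)
  then show ?thesis
    by (intro left_module.intro left_module_axioms.intro R.ring_axioms)
      (auto simp: R.func_space_def R.l_distr R.r_distr R.m_assoc mem ext intro!: eqI)
qed

lemma (in left_module) finsum_lsmult:
  assumes "finite I" "a \<in> carrier R" "g \<in> I \<rightarrow> carrier M"
  shows "a \<odot>\<^bsub>M\<^esub> finsum M g I = finsum M (\<lambda>i. a \<odot>\<^bsub>M\<^esub> g i) I"
  using assms(1,3)
proof (induction I)
  case empty
  then show ?case using assms(2) by (simp add: lsmult_zero)
next
  case (insert i I)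
  then have g: "g i \<in> carrier M" "g \<in> I \<rightarrow> carrier M" by auto
  moreover have "(\<lambda>i. a \<odot>\<^bsub>M\<^esub> g i) \<in> I \<rightarrow> carrier M" using g assms(2) lsmult_closed by auto
  ultimately show ?case
    using insert assms(2) by (simp add: M.finsum_insert lsmult_closed lsmult_r_distr M.finsum_closed)
qed

text \<open>
  The universal property of the free module: a family in \<open>M\<close> extends to a homomorphism that
  sends the standard basis to the family.
\<close>

lemma evaluation_Hom:
  assumes M: "left_module R M" and I: "finite I" and b: "\<And>i. i \<in> I \<Longrightarrow> b i \<in> carrier M"
  defines "\<phi> \<equiv> (\<lambda>f\<in>I \<rightarrow>\<^sub>E carrier R. finsum M (\<lambda>i. f i \<odot>\<^bsub>M\<^esub> b i) I)"
  shows "\<phi> \<in> Hom R (ring.func_space R I) M"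
    and "i \<in> I \<Longrightarrow> \<phi> (\<lambda>j\<in>I. if j = i then \<one>\<^bsub>R\<^esub> else \<zero>\<^bsub>R\<^esub>) = b i"
proof -
  interpret M: left_module R M by fact
  have cl: "(\<lambda>i. f i \<odot>\<^bsub>M\<^esub> b i) \<in> I \<rightarrow> carrier M" if "f \<in> I \<rightarrow>\<^sub>E carrier R" for f
    using that b by (auto intro!: M.lsmult_closed)
  show "\<phi> \<in> Hom R (ring.func_space R I) M"
  proof (rule HomI)
    fix f assume f: "f \<in> carrier (ring.func_space R I)"
    then have f': "f \<in> I \<rightarrow>\<^sub>E carrier R" by (simp add: M.R.func_space_def)
    then have fi: "f i \<in> carrier R" if "i \<in> I" for i using that by auto
    show "\<phi> f \<in> carrier M" using f' cl by (simp add: \<phi>_def M.finsum_closed)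
    show "\<phi> (a \<odot>\<^bsub>ring.func_space R I\<^esub> f) = a \<odot>\<^bsub>M\<^esub> \<phi> f" if a: "a \<in> carrier R" for a
    proof -
      have af: "(\<lambda>i\<in>I. a \<otimes>\<^bsub>R\<^esub> f i) \<in> I \<rightarrow>\<^sub>E carrier R" using a f' by auto
      have "\<phi> (a \<odot>\<^bsub>ring.func_space R I\<^esub> f) = finsum M (\<lambda>i. (\<lambda>i\<in>I. a \<otimes>\<^bsub>R\<^esub> f i) i \<odot>\<^bsub>M\<^esub> b i) I"
        using af by (simp add: \<phi>_def M.R.func_space_def)
      also have "\<dots> = finsum M (\<lambda>i. a \<odot>\<^bsub>M\<^esub> (f i \<odot>\<^bsub>M\<^esub> b i)) I"
        using a b fi by (intro M.finsum_cong') (auto simp: M.lsmult_assoc intro!: M.lsmult_closed)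
      finally show ?thesis
        using f' M.finsum_lsmult[OF I a cl[OF f']] by (simp add: \<phi>_def)
    qed
    fix g assume "g \<in> carrier (ring.func_space R I)"
    then have g': "g \<in> I \<rightarrow>\<^sub>E carrier R" by (simp add: M.R.func_space_def)
    then have gi: "g i \<in> carrier R" if "i \<in> I" for i using that by auto
    have fg: "(\<lambda>i\<in>I. f i \<oplus>\<^bsub>R\<^esub> g i) \<in> I \<rightarrow>\<^sub>E carrier R" using f' g' by auto
    have "\<phi> (f \<oplus>\<^bsub>ring.func_space R I\<^esub> g) = finsum M (\<lambda>i. (\<lambda>i\<in>I. f i \<oplus>\<^bsub>R\<^esub> g i) i \<odot>\<^bsub>M\<^esub> b i) I"
      using fg by (simp add: \<phi>_def M.R.func_space_def)
    also have "\<dots> = finsum M (\<lambda>i. f i \<odot>\<^bsub>M\<^esub> b i \<oplus>\<^bsub>M\<^esub> g i \<odot>\<^bsub>M\<^esub> b i) I"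
      using b fi gi
      by (intro M.finsum_cong') (auto simp: M.lsmult_l_distr intro!: M.lsmult_closed M.a_closed)
    also have "\<dots> = finsum M (\<lambda>i. f i \<odot>\<^bsub>M\<^esub> b i) I \<oplus>\<^bsub>M\<^esub> finsum M (\<lambda>i. g i \<odot>\<^bsub>M\<^esub> b i) I"
      using cl[OF f'] cl[OF g'] by (rule M.finsum_addf)
    finally show "\<phi> (f \<oplus>\<^bsub>ring.func_space R I\<^esub> g) = \<phi> f \<oplus>\<^bsub>M\<^esub> \<phi> g"
      using f' g' by (simp add: \<phi>_def)
  qed (simp add: \<phi>_def M.R.func_space_def)
  assume i: "i \<in> I"
  let ?e = "\<lambda>j\<in>I. if j = i then \<one>\<^bsub>R\<^esub> else \<zero>\<^bsub>R\<^esub>"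
  have e: "?e \<in> I \<rightarrow>\<^sub>E carrier R" by auto
  have "\<phi> ?e = finsum M (\<lambda>j. ?e j \<odot>\<^bsub>M\<^esub> b j) I" using e by (simp only: \<phi>_def restrict_apply')
  also have "\<dots> = finsum M (\<lambda>j. if i = j then b j else \<zero>\<^bsub>M\<^esub>) I"
    using b by (intro M.finsum_cong') (auto simp: M.lsmult_one M.zero_lsmult)
  also have "\<dots> = b i" using i I b by (intro M.add.finprod_singleton) auto
  finally show "\<phi> ?e = b i" .
qed

lemma (in vectorspace) smult_nonzero_inj:
  assumes x: "x \<in> carrier V" "x \<noteq> \<zero>\<^bsub>V\<^esub>"
  shows "inj_on (\<lambda>c. c \<odot>\<^bsub>V\<^esub> x) (carrier K)"
proof (rule inj_onI, rule ccontr)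
  fix c c' assume cc': "c \<in> carrier K" "c' \<in> carrier K"
    and eq: "c \<odot>\<^bsub>V\<^esub> x = c' \<odot>\<^bsub>V\<^esub> x" and "c \<noteq> c'"
  let ?d = "c \<oplus>\<^bsub>K\<^esub> \<ominus>\<^bsub>K\<^esub> c'"
  have d: "?d \<in> carrier K" "?d \<noteq> \<zero>\<^bsub>K\<^esub>"
    using \<open>c \<noteq> c'\<close> cc' R.minus_equality[of c "\<ominus>\<^bsub>K\<^esub> c'"] by auto
  have "?d \<odot>\<^bsub>V\<^esub> x = (c' \<oplus>\<^bsub>K\<^esub> \<ominus>\<^bsub>K\<^esub> c') \<odot>\<^bsub>V\<^esub> x"
    using cc' x(1) by (simp only: smult_l_distr R.a_inv_closed eq)
  also have "\<dots> = \<zero>\<^bsub>V\<^esub>" using cc' x(1) by (simp only: R.r_neg lmult_0)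
  finally have "x = inv\<^bsub>K\<^esub> ?d \<odot>\<^bsub>V\<^esub> \<zero>\<^bsub>V\<^esub>"
    using d x(1) by (intro mult_inverse) auto
  then show False using x(2) d by (simp add: field_Units)
qed

context plain_fd_algebra
begin

text \<open>
  The vectors that have a member of a spanning set of the algebra in one coordinate and zero in the
  others span the free module: for a fixed coordinate the elements of the algebra that can be
  placed there form a subspace which contains the spanning set, and a general vector is built up
  coordinate by coordinate.
\<close>

lemma func_space_fd:
  assumes I: "finite I"
  shows "ring.func_space A I \<in> fd_modules K A"
proof -
  let ?P = "ring.func_space A I"
  let ?V = "underlying_vs A ?P"
  have P: "left_module A ?P" using A.ring_axioms by (rule left_module_func_space)
  have func: "carrier ?P = I \<rightarrow>\<^sub>E carrier A" "\<zero>\<^bsub>?P\<^esub> = (\<lambda>i\<in>I. \<zero>\<^bsub>A\<^esub>)"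
    "f \<oplus>\<^bsub>?P\<^esub> g = (\<lambda>i\<in>I. f i \<oplus>\<^bsub>A\<^esub> g i)" "a \<odot>\<^bsub>?P\<^esub> f = (\<lambda>i\<in>I. a \<otimes>\<^bsub>A\<^esub> f i)" for f g a
    by (simp_all add: ring.func_space_def[OF A.ring_axioms])
  interpret V: vectorspace K ?V using P by (rule underlying_vs_vectorspace)
  obtain B where B: "finite B" "B \<subseteq> carrier A" "span B = carrier A"
    using finite_dimensional by (auto simp: fin_dim_def)
  define e where "e i a = (\<lambda>j\<in>I. if j = i then a else \<zero>\<^bsub>A\<^esub>)" for i a
  define E where "E = (\<lambda>(i, b). e i b) ` (I \<times> B)"
  have E: "finite E" "E \<subseteq> carrier ?V" using I B by (auto simp: E_def e_def func)
  note S = V.span_is_submodule[OF E(2)]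
  have S_add: "f \<oplus>\<^bsub>?V\<^esub> g \<in> V.span E" if "f \<in> V.span E" "g \<in> V.span E" for f g
    using S that by (auto simp: LinearCombinations.submodule_def)
  have S_zero: "\<zero>\<^bsub>?V\<^esub> \<in> V.span E"
    using S by (auto simp: LinearCombinations.submodule_def)
  have S_smult: "c \<odot>\<^bsub>?V\<^esub> f \<in> V.span E" if "c \<in> carrier K" "f \<in> V.span E" for c f
    using S that unfolding LinearCombinations.submodule_def by blast
  have eS: "e i a \<in> V.span E" if i: "i \<in> I" and a: "a \<in> carrier A" for i a
  proof -
    let ?T = "{a \<in> carrier A. e i a \<in> V.span E}"
    have "LinearCombinations.submodule K ?T A"
    proof (rule LinearCombinations.submodule.intro)
      show "module K A" by (rule module_axioms)
      show "x \<oplus>\<^bsub>A\<^esub> y \<in> ?T" if "x \<in> ?T" "y \<in> ?T" for x y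
      proof -
        have "e i (x \<oplus>\<^bsub>A\<^esub> y) = e i x \<oplus>\<^bsub>?V\<^esub> e i y" using that by (auto simp: e_def func)
        then show ?thesis using that S_add[of "e i x" "e i y"] by simp
      qed
      have "e i \<zero>\<^bsub>A\<^esub> = \<zero>\<^bsub>?V\<^esub>" by (auto simp: e_def func)
      then show "\<zero>\<^bsub>A\<^esub> \<in> ?T" using S_zero by simp
      show "c \<odot>\<^bsub>A\<^esub> x \<in> ?T" if "c \<in> carrier K" "x \<in> ?T" for c x
      proof -
        have "e i (c \<odot>\<^bsub>A\<^esub> x) = c \<odot>\<^bsub>?V\<^esub> e i x"
          using that by (auto simp: e_def func scalar_mult)
        then show ?thesis using that S_smult[of c "e i x"] by simp
      qed
    qed auto
    moreover have "B \<subseteq> ?T"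
      using B(2) i V.in_own_span[OF E(2)] by (auto simp: E_def)
    ultimately show ?thesis using span_is_subset[of B ?T] B(3) a by blast
  qed
  have "f \<in> V.span E" if f: "f \<in> carrier ?V" for f
  proof -
    have f': "f \<in> I \<rightarrow>\<^sub>E carrier A" using f by (simp add: func)
    then have fi: "f i \<in> carrier A" if "i \<in> I" for i using that by auto
    have "(\<lambda>i\<in>I. if i \<in> J then f i else \<zero>\<^bsub>A\<^esub>) \<in> V.span E" if "finite J" "J \<subseteq> I" for J
      using that
    proof (induction J)
      case empty
      then show ?case using S_zero by (simp add: func restrict_def)
    next
      case (insert j J)
      have eq: "(\<lambda>i\<in>I. if i \<in> insert j J then f i else \<zero>\<^bsub>A\<^esub>)
          = e j (f j) \<oplus>\<^bsub>?V\<^esub> (\<lambda>i\<in>I. if i \<in> J then f i else \<zero>\<^bsub>A\<^esub>)"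
        using insert.hyps insert.prems fi
        by (intro extensionalityI[of _ I]) (auto simp: func e_def)
      show ?case
        unfolding eq using insert.prems fi by (intro S_add eS insert.IH) auto
    qed
    from this[OF I subset_refl] have "(\<lambda>i\<in>I. if i \<in> I then f i else \<zero>\<^bsub>A\<^esub>) \<in> V.span E" .
    moreover have "(\<lambda>i\<in>I. if i \<in> I then f i else \<zero>\<^bsub>A\<^esub>) = f"
      using f' by (auto simp: PiE_def extensional_def)
    ultimately show ?thesis by simp
  qed
  then have "V.span E = carrier ?V" using V.span_is_subset2[OF E(2)] by blast
  then have "V.fin_dim" using E unfolding V.fin_dim_def by blast
  then show ?thesis using P by (simp add: fd_modules_def)
qed

text \<open>
  A basis over the field also generates the module over the algebra.  The rank of the free module
  therefore depends only on the dimension, which is what makes a uniform bound possible.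
\<close>

lemma fd_module_quotient_of_free:
  assumes M: "M \<in> fd_modules K A"
  obtains f where "f \<in> Hom A (ring.func_space A {..<fd_dim K A M}) M"
    "f ` carrier (ring.func_space A {..<fd_dim K A M}) = carrier M"
proof -
  let ?V = "underlying_vs A M" and ?I = "{..<fd_dim K A M}"
  have M': "left_module A M" "vectorspace.fin_dim K ?V" using M by (auto simp: fd_modules_def)
  interpret V: vectorspace K ?V using M'(1) by (rule underlying_vs_vectorspace)
  obtain B where B: "finite B" "V.basis B" using V.finite_basis_exists[OF M'(2)] by blast
  then have "card B = fd_dim K A M" using V.dim_basis by (simp add: fd_dim_def)
  then obtain b where b: "bij_betw b ?I B"
    using ex_bij_betw_nat_finite[OF B(1)] by (auto simp: atLeast0LessThan)
  have BM: "B \<subseteq> carrier M" using B(2) by (simp add: V.basis_def)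
  then have bM: "b i \<in> carrier M" if "i \<in> ?I" for i using b that by (auto simp: bij_betw_def)
  define f where "f = (\<lambda>f\<in>?I \<rightarrow>\<^sub>E carrier A. finsum M (\<lambda>i. f i \<odot>\<^bsub>M\<^esub> b i) ?I)"
  let ?P = "ring.func_space A ?I"
  note f = evaluation_Hom[where b = b and I = ?I, OF M'(1) finite_lessThan bM, folded f_def]
  have P: "left_module A ?P" using A.ring_axioms by (rule left_module_func_space)
  have P_carr: "carrier ?P = ?I \<rightarrow>\<^sub>E carrier A" by (simp add: ring.func_space_def[OF A.ring_axioms])
  have sub: "Module.submodule (f ` carrier ?P) A M"
    using P M'(1) f(1) by (rule submodule_image) 
  note sub' = left_module.submodule_subset[OF M'(1) sub] left_module.submodule_zero[OF M'(1) sub]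
    left_module.submodule_add[OF M'(1) sub] left_module.submodule_smult[OF M'(1) sub]
  have "LinearCombinations.submodule K (f ` carrier ?P) ?V"
    using sub' V.module_axioms by (intro LinearCombinations.submodule.intro) auto
  moreover have "x \<in> f ` carrier ?P" if "x \<in> B" for x
  proof -
    have "x \<in> b ` ?I" using b that by (simp add: bij_betw_def)
    then obtain i where i: "i \<in> ?I" "x = b i" by blast
    have "(\<lambda>j\<in>?I. if j = i then \<one>\<^bsub>A\<^esub> else \<zero>\<^bsub>A\<^esub>) \<in> carrier ?P" unfolding P_carr by auto
    then show ?thesis using f(2)[OF _ i(1)] unfolding i(2) by (metis imageI)
  qed
  ultimately have "V.span B \<subseteq> f ` carrier ?P" by (intro V.span_is_subset) auto
  then have "f ` carrier ?P = carrier M" using B(2) sub'(1) by (auto simp: V.basis_def)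
  then show ?thesis using f(1) that by blast
qed

text \<open>
  A free module of finite rank fits into every universe that contains a nonzero module.  By
  coordinates with respect to a spanning set, the algebra embeds as a set into a finite power of
  the field, hence into the infinite field itself; so does each finite power of the algebra.
  Finally the field embeds into \<open>M\<close> by acting on a nonzero element.
\<close>

lemma free_carrier_embeds:
  fixes M :: "('a, 'm) module"
  assumes K: "infinite (carrier K)" and M: "left_module A M" "carrier M \<noteq> {\<zero>\<^bsub>M\<^esub>}"
    and I: "finite I"
  obtains h :: "('i \<Rightarrow> 'a) \<Rightarrow> 'm" where "inj_on h (I \<rightarrow>\<^sub>E carrier A)"
proof -
  interpret V: vectorspace K "underlying_vs A M" using M(1) by (rule underlying_vs_vectorspace)
  obtain B where B: "finite B" "B \<subseteq> carrier A" "span B = carrier A"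
    using finite_dimensional by (auto simp: fin_dim_def)
  obtain k :: "('a \<Rightarrow> 'k) \<Rightarrow> 'k" where k: "inj_on k (B \<rightarrow>\<^sub>E carrier K)" "k ` (B \<rightarrow>\<^sub>E carrier K) \<subseteq> carrier K"
    using PiE_embeds_in_infinite[OF K B(1), of id "carrier K"] by auto
  have "\<exists>c. c \<in> B \<rightarrow>\<^sub>E carrier K \<and> lincomb c B = a" if "a \<in> carrier A" for a
  proof -
    obtain c where c: "c \<in> B \<rightarrow> carrier K" "lincomb c B = a"
      using finite_in_span[OF B(1,2)] B(3) \<open>a \<in> carrier A\<close> by blast
    moreover have "lincomb (restrict c B) B = lincomb c B"
      using B(2) c(1) by (intro lincomb_cong) auto
    ultimately show ?thesis by (intro exI[of _ "restrict c B"]) auto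
  qed
  then obtain c where c: "\<And>a. a \<in> carrier A \<Longrightarrow> c a \<in> B \<rightarrow>\<^sub>E carrier K \<and> lincomb (c a) B = a"
    by metis
  have "inj_on (k \<circ> c) (carrier A)" "(k \<circ> c) ` carrier A \<subseteq> carrier K"
    using c k by (auto simp: inj_on_def) metis
  from PiE_embeds_in_infinite[OF K I this]
  obtain h :: "('i \<Rightarrow> 'a) \<Rightarrow> 'k" where h: "inj_on h (I \<rightarrow>\<^sub>E carrier A)" "h ` (I \<rightarrow>\<^sub>E carrier A) \<subseteq> carrier K"
    by blast
  obtain x where x: "x \<in> carrier M" "x \<noteq> \<zero>\<^bsub>M\<^esub>"
    using M V.M.zero_closed by auto
  have "inj_on (\<lambda>c. c \<odot>\<^bsub>underlying_vs A M\<^esub> x) (carrier K)"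
    using x by (intro V.smult_nonzero_inj) auto
  then have "inj_on ((\<lambda>c. c \<odot>\<^bsub>underlying_vs A M\<^esub> x) \<circ> h) (I \<rightarrow>\<^sub>E carrier A)"
    using h by (intro comp_inj_on) (auto intro: inj_on_subset)
  then show ?thesis by (rule that)
qed

end

section \<open>Brick-continuity under exact functors\<close>

text \<open>
  Over an infinite field, any universe with a nonzero module contains one finite-dimensional
  module, a copy of the free module of rank \<open>d\<close>, that has every module of dimension \<open>d\<close> in this universe as a quotient.
\<close>

lemma (in plain_fd_algebra) fd_generator_exists:
  fixes M :: "('a, 'm) module"
  assumes K: "infinite (carrier K)" and M: "left_module A M" "carrier M \<noteq> {\<zero>\<^bsub>M\<^esub>}"
  obtains P :: "('a, 'm) module" where "P \<in> fd_modules K A"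
    "\<And>N :: ('a, 'm) module. \<lbrakk>N \<in> fd_modules K A; fd_dim K A N = d\<rbrakk>
      \<Longrightarrow> \<exists>f\<in>Hom A P N. f ` carrier P = carrier N"
proof -
  let ?F = "ring.func_space A {..<d}"
  have F: "left_module A ?F" using A.ring_axioms by (rule left_module_func_space)
  have F_carr: "carrier ?F = {..<d} \<rightarrow>\<^sub>E carrier A" by (simp add: ring.func_space_def[OF A.ring_axioms])
  obtain h :: "(nat \<Rightarrow> 'a) \<Rightarrow> 'm" where h: "inj_on h (carrier ?F)"
    using free_carrier_embeds[OF K M finite_lessThan[of d]] unfolding F_carr by blast
  let ?P = "image_module h ?F" and ?g = "\<lambda>x\<in>carrier ?F. h x"
  have cong: "\<lbrakk>x \<in> carrier ?F; x' \<in> carrier ?F; y \<in> carrier ?F; y' \<in> carrier ?F; h x = h x'; h y = h y'\<rbrakk>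
      \<Longrightarrow> h (x \<oplus>\<^bsub>?F\<^esub> y) = h (x' \<oplus>\<^bsub>?F\<^esub> y')"
    "\<lbrakk>a \<in> carrier A; x \<in> carrier ?F; x' \<in> carrier ?F; h x = h x'\<rbrakk>
      \<Longrightarrow> h (a \<odot>\<^bsub>?F\<^esub> x) = h (a \<odot>\<^bsub>?F\<^esub> x')" for a x x' y y'
    using inj_onD[OF h] by metis+
  have P: "left_module A ?P" using F cong by (rule left_module_image_module[where q = h])
  have g: "?g \<in> Hom A ?F ?P" using F cong by (rule image_module_Hom[where q = h])
  have g_bij: "bij_betw ?g (carrier ?F) (carrier ?P)"
    using h by (auto simp: bij_betw_def carrier_image_module inj_on_def)
  let ?k = "\<lambda>y\<in>carrier ?P. inv_into (carrier ?F) ?g y"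
  have k: "?k \<in> Hom A ?P ?F" using F g g_bij by (rule inverse_Hom)
  have k_im: "?k ` carrier ?P = carrier ?F"
    using bij_betw_inv_into[OF g_bij] by (auto simp: bij_betw_def)
  show ?thesis
  proof (rule that)
    show "?P \<in> fd_modules K A"
      using func_space_fd[OF finite_lessThan] P g bij_betw_imp_surj_on[OF g_bij]
      by (rule fd_modules_image)
    fix N :: "('a, 'm) module"
    assume N: "N \<in> fd_modules K A" "fd_dim K A N = d"
    obtain f where f: "f \<in> Hom A ?F N" "f ` carrier ?F = carrier N"
      using fd_module_quotient_of_free[OF N(1)] unfolding N(2) by blast
    have "compose (carrier ?P) f ?k ` carrier ?P = f ` (?k ` carrier ?P)"
      by (simp only: image_image compose_eq cong: image_cong)
    then have "compose (carrier ?P) f ?k ` carrier ?P = carrier N"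
      unfolding k_im f(2) .
    then show "\<exists>f\<in>Hom A ?P N. f ` carrier ?P = carrier N"
      using compose_Hom[OF P k f(1)] by blast
  qed
qed

text \<open>
  Exactness turns the epimorphisms from the common source \<open>P\<close> into epimorphisms from the image of
  \<open>P\<close>, so the dimensions of the images of the bricks of dimension \<open>d\<close> are bounded.  By the
  pigeonhole principle infinitely many images share a dimension, and they are pairwise
  non-isomorphic because a fully faithful functor reflects isomorphisms.
\<close>

lemma brick_continuous_transfer:
  fixes A :: "('k, 'a) module" and A' :: "('k, 'b) module"
    and F :: "('b, 'm, 'a, 'n) mod_functor"
  assumes K: "infinite (carrier K)" and A: "fd_algebra K A" and A': "fd_algebra K A'"
    and F: "fully_faithful_functor A' (fd_modules K A') A (fd_modules K A) F"
    and exact: "exact_functor A' (fd_modules K A') A F"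
    and bc: "brick_continuous TYPE('m) K A'"
  shows "brick_continuous TYPE('n) K A"
proof -
  interpret F: fully_faithful_functor A' "fd_modules K A'" A "fd_modules K A" F by fact
  interpret A: plain_fd_algebra K A using A by (rule plain_fd_algebra.intro)
  interpret A': plain_fd_algebra K A' using A' by (rule plain_fd_algebra.intro)
  obtain d and \<B> :: "('b, 'm) module set" where inf: "infinite \<B>"
    and \<B>: "\<And>M. M \<in> \<B> \<Longrightarrow> M \<in> fd_modules K A' \<and> brick A' M \<and> fd_dim K A' M = d"
    and noniso: "\<And>M N. \<lbrakk>M \<in> \<B>; N \<in> \<B>; M \<noteq> N\<rbrakk> \<Longrightarrow> \<not> isomorphic_modules A' M N"
    using bc unfolding brick_continuous_def by blast
  obtain M0 where "M0 \<in> \<B>" using inf by (metis finite.emptyI ex_in_conv)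
  then have M0: "left_module A' M0" "carrier M0 \<noteq> {\<zero>\<^bsub>M0\<^esub>}"
    using \<B> F.left_module_source brick_not_zero by blast+
  obtain P :: "('b, 'm) module" where P: "P \<in> fd_modules K A'"
    and gen: "\<And>N :: ('b, 'm) module. \<lbrakk>N \<in> fd_modules K A'; fd_dim K A' N = d\<rbrakk>
      \<Longrightarrow> \<exists>f\<in>Hom A' P N. f ` carrier P = carrier N"
    by (rule A'.fd_generator_exists[OF K M0, where d = d]) blast
  have bound: "fd_dim K A (obj F M) \<le> fd_dim K A (obj F P)" if "M \<in> \<B>" for M
  proof -
    have M: "M \<in> fd_modules K A'" "fd_dim K A' M = d" using \<B>[OF that] by auto
    obtain f where f: "f \<in> Hom A' P M" "f ` carrier P = carrier M" using gen[OF M] by blast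
    let ?L = "{x \<in> carrier P. f x = \<zero>\<^bsub>M\<^esub>}"
    note lm = F.left_module_source[OF P] F.left_module_source[OF M(1)]
    have L: "P\<lparr>carrier := ?L\<rparr> \<in> fd_modules K A'"
      using P submodule_kernel[OF lm f(1)] by (rule A'.fd_modules_submodule)
    have "short_exact A (obj F (P\<lparr>carrier := ?L\<rparr>)) (obj F P) (obj F M)
        (arr F (P\<lparr>carrier := ?L\<rparr>) P (\<lambda>x\<in>?L. x)) (arr F P M f)"
      using exact L P M(1) short_exact_kernel[OF lm f] by (rule exact_functorD)
    then have "arr F P M f ` carrier (obj F P) = carrier (obj F M)"
      by (simp add: short_exact_def)
    then show ?thesis
      using F.obj_closed[OF P] F.left_module_obj[OF M(1)] F.arr_closed[OF P M(1) f(1)]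
      by (intro A.fd_dim_image_le)
  qed
  have iso: "isomorphic_modules A (obj F M) (obj F M)" if "M \<in> \<B>" for M
    unfolding isomorphic_modules_def
    using \<B>[OF that] identity_Hom[OF F.left_module_obj]
    by (intro bexI[of _ "\<lambda>x\<in>carrier (obj F M). x"]) (auto simp: bij_betw_def inj_on_def)
  have reflect: "M = N" if "M \<in> \<B>" "N \<in> \<B>" "isomorphic_modules A (obj F M) (obj F N)" for M N
    using that noniso[of M N] \<B> F.reflects_isomorphic[of M N] by blast
  have inj: "inj_on (obj F) \<B>"
  proof (rule inj_onI)
    fix M N assume "M \<in> \<B>" "N \<in> \<B>" "obj F M = obj F N"
    then show "M = N" using reflect iso[of M] by simp
  qed
  have "finite ((\<lambda>M. fd_dim K A (obj F M)) ` \<B>)"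
    using bound by (intro finite_subset[OF _ finite_atMost[of "fd_dim K A (obj F P)"]]) auto
  with inf obtain M1 where "infinite {M \<in> \<B>. fd_dim K A (obj F M) = fd_dim K A (obj F M1)}"
    using pigeonhole_infinite by blast
  then have inf': "infinite (obj F ` {M \<in> \<B>. fd_dim K A (obj F M) = fd_dim K A (obj F M1)})"
    using inj by (subst finite_image_iff) (auto intro: inj_on_subset)
  show ?thesis
    unfolding brick_continuous_def
  proof (intro exI conjI)
    show "infinite (obj F ` {M \<in> \<B>. fd_dim K A (obj F M) = fd_dim K A (obj F M1)})" by fact
    show "\<forall>N\<in>obj F ` {M \<in> \<B>. fd_dim K A (obj F M) = fd_dim K A (obj F M1)}.
        N \<in> fd_modules K A \<and> brick A N \<and> fd_dim K A N = fd_dim K A (obj F M1)"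
      using \<B> F.obj_closed F.brick_obj by auto
    show "\<forall>N\<in>obj F ` {M \<in> \<B>. fd_dim K A (obj F M) = fd_dim K A (obj F M1)}.
        \<forall>N'\<in>obj F ` {M \<in> \<B>. fd_dim K A (obj F M) = fd_dim K A (obj F M1)}.
        N \<noteq> N' \<longrightarrow> \<not> isomorphic_modules A N N'"
      using reflect by auto
  qed
qed

theorem theorem2p18:
  fixes K :: "('k, 'c) ring_scheme"
    and \<Lambda> :: "('k, 'a) module"
    and \<Lambda>' :: "('k, 'b) module"
    and F :: "('b, 'm, 'a, 'n) mod_functor"
    and G :: "('b, 'u, 'a, 'v) mod_functor"
  assumes "algebraically_closed K"
    and "fd_algebra K \<Lambda>"
    and "fd_algebra K \<Lambda>'"
  shows
    "(brick_continuous TYPE('m) K \<Lambda>' \<and>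
      module_functor \<Lambda>' (fd_modules K \<Lambda>') \<Lambda> (fd_modules K \<Lambda>) F \<and>
      fully_faithful \<Lambda>' (fd_modules K \<Lambda>') \<Lambda> F \<and>
      exact_functor \<Lambda>' (fd_modules K \<Lambda>') \<Lambda> F
      \<longrightarrow> brick_continuous TYPE('n) K \<Lambda>) \<and>
     ((\<exists>M :: ('b, 'u) module. generic_brick \<Lambda>' M) \<and>
      module_functor \<Lambda>' (all_modules \<Lambda>') \<Lambda> (all_modules \<Lambda>) G \<and>
      fully_faithful \<Lambda>' (all_modules \<Lambda>') \<Lambda> G \<and>
      exact_functor \<Lambda>' (all_modules \<Lambda>') \<Lambda> G \<and>
      (\<forall>M\<in>all_modules \<Lambda>'. endofinite \<Lambda>' M \<longrightarrow> endofinite \<Lambda> (obj G M))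
      \<longrightarrow> (\<exists>N :: ('a, 'v) module. generic_brick \<Lambda> N))"
proof (intro conjI impI; elim conjE)
  assume bc: "brick_continuous TYPE('m) K \<Lambda>'"
    and F: "module_functor \<Lambda>' (fd_modules K \<Lambda>') \<Lambda> (fd_modules K \<Lambda>) F"
      "fully_faithful \<Lambda>' (fd_modules K \<Lambda>') \<Lambda> F"
      "exact_functor \<Lambda>' (fd_modules K \<Lambda>') \<Lambda> F"
  have "fully_faithful_functor \<Lambda>' (fd_modules K \<Lambda>') \<Lambda> (fd_modules K \<Lambda>) F"
    by (intro fully_faithful_functor.intro fully_faithful_functor_axioms.intro F)
      (auto simp: fd_modules_def all_modules_def)
  with algebraically_closed.infinite_carrier[OF assms(1)] assms(2,3)
  show "brick_continuous TYPE('n) K \<Lambda>"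
    using F(3) bc by (rule brick_continuous_transfer)
next
  assume "\<exists>M :: ('b, 'u) module. generic_brick \<Lambda>' M"
    and G: "module_functor \<Lambda>' (all_modules \<Lambda>') \<Lambda> (all_modules \<Lambda>) G"
      "fully_faithful \<Lambda>' (all_modules \<Lambda>') \<Lambda> G" "exact_functor \<Lambda>' (all_modules \<Lambda>') \<Lambda> G"
    and fin: "\<forall>M\<in>all_modules \<Lambda>'. endofinite \<Lambda>' M \<longrightarrow> endofinite \<Lambda> (obj G M)"
  then obtain M :: "('b, 'u) module" where M: "generic_brick \<Lambda>' M" by blast
  then have "endofinite \<Lambda> (obj G M)"
    using fin by (auto simp: generic_brick_def generic_module_def all_modules_def)
  moreover have "fully_faithful_functor \<Lambda>' (all_modules \<Lambda>') \<Lambda> (all_modules \<Lambda>) G"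
    by (intro fully_faithful_functor.intro fully_faithful_functor_axioms.intro G(1,2) subset_refl)
  ultimately have "generic_brick \<Lambda> (obj G M)"
    using G(3) M by (intro generic_brick_obj[where F = G])
  then show "\<exists>N :: ('a, 'v) module. generic_brick \<Lambda> N" by blast
qed

end
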